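(* The parameterized problem Max-$r$-Lin2-AA[$k,r$] has a kernel with at most $(2k-1)r$ variables; that is, there is a polynomial-time algorithm mapping any instance to an equivalent instance of Max-$r$-Lin2-AA[$k,r$] whose parameters are bounded by functions of $k$ and $r$ and whose system has at most $(2k-1)r$ variables.
   Context: An instance of Max-$r$-Lin2-AA consists of a system $S$ of $m$ equations $\prod_{i\in I_j}x_i=b_j$, $j=1,\dots,m$, in variables $x_1,\dots,x_n$, where $\emptyset\ne I_j\subseteq[n]$, $|I_j|\le r$, $x_i,b_j\in\{-1,1\}$; equation $j$ has a positive integral weight $w_j$; and a nonnegative integer $k$. With $W=\sum_j w_j$ and $\mathrm{sat}(S)$ the maximum total weight of equations simultaneously satisfiable by an assignment in $\{-1,1\}^n$, the question is whether $\mathrm{sat}(S)\ge W/2+k$. In Max-$r$-Lin2-AA[$k,r$], both $k$ and $r$ are parameters.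
   Formalization: For k = 0 the bound (2k-1)r is read as 0, since the literal value -r is negative when r > 0 and no system can have that many variables; for k at least 1 the bound is unchanged. *)

theory Defs
  imports Complex_Main "HOL-Library.FuncSet" "HOL-Library.Log_Nat"
    "HOL-Computational_Algebra.Polynomial"
begin

section \<open>Polynomial-time computation\<close>

text \<open>
  The model of computation is a first-order functional language with recursive functions, working
  on binary trees whose leaves are natural numbers in binary.  A value has the size of its binary
  representation.  Every evaluated subexpression is charged at least one unit, and every variable
  lookup, literal and primitive operation is charged the full size of its result; its operands have
  been charged when they were computed.  All primitives are computable in time polynomial in the
  sizes of operands and result, so a run of cost t can be simulated by a Turing machine in time
  polynomial in t and the input size; conversely a Turing machine can be simulated with polynomial
  overhead.  Hence polynomial cost means polynomial time in the usual sense.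
\<close>

datatype val = Num nat | Pair val val

primrec val_size :: "val \<Rightarrow> nat" where
  "val_size (Num n) = 1 + floorlog 2 n"
| "val_size (Pair u v) = 1 + val_size u + val_size v"

datatype unop = Fst | Snd | IsPair

datatype binop = MkPair | Plus | Minus | Times | Quot | Less | Equal

fun apply_unop :: "unop \<Rightarrow> val \<Rightarrow> val option" where
  "apply_unop Fst (Pair u v) = Some u"
| "apply_unop Snd (Pair u v) = Some v"
| "apply_unop IsPair (Pair u v) = Some (Num 1)"
| "apply_unop IsPair (Num n) = Some (Num 0)"
| "apply_unop _ _ = None"

fun apply_binop :: "binop \<Rightarrow> val \<Rightarrow> val \<Rightarrow> val option" where
  "apply_binop MkPair u v = Some (Pair u v)"
| "apply_binop Equal u v = Some (Num (of_bool (u = v)))"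
| "apply_binop Plus (Num a) (Num b) = Some (Num (a + b))"
| "apply_binop Minus (Num a) (Num b) = Some (Num (a - b))"
| "apply_binop Times (Num a) (Num b) = Some (Num (a * b))"
| "apply_binop Quot (Num a) (Num b) = Some (Num (a div b))"
| "apply_binop Less (Num a) (Num b) = Some (Num (of_bool (a < b)))"
| "apply_binop _ _ _ = None"

text \<open>
  Variables are de Bruijn indices into the environment.  A call of the function with number f
  evaluates the f-th body of the program in the environment consisting of the arguments only.
\<close>

datatype expr =
    EVar nat
  | ELit nat
  | EUn unop expr
  | EBin binop expr expr
  | EIf expr expr expr
  | ELet expr expr
  | ECall nat "expr list"

type_synonym program = "expr list"

text \<open>big_step P env e v t: in the environment env, the expression e evaluates to v at cost t.\<close>

inductive big_step :: "program \<Rightarrow> val list \<Rightarrow> expr \<Rightarrow> val \<Rightarrow> nat \<Rightarrow> bool"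
  and big_steps :: "program \<Rightarrow> val list \<Rightarrow> expr list \<Rightarrow> val list \<Rightarrow> nat \<Rightarrow> bool"
  for P :: program
where
  big_step_var: "i < length env \<Longrightarrow> big_step P env (EVar i) (env ! i) (val_size (env ! i))"
| big_step_lit: "big_step P env (ELit n) (Num n) (val_size (Num n))"
| big_step_un: "big_step P env e v t \<Longrightarrow> apply_unop f v = Some u
    \<Longrightarrow> big_step P env (EUn f e) u (t + val_size u)"
| big_step_bin: "big_step P env e1 v1 t1 \<Longrightarrow> big_step P env e2 v2 t2 \<Longrightarrow> apply_binop f v1 v2 = Some u
    \<Longrightarrow> big_step P env (EBin f e1 e2) u (t1 + t2 + val_size u)"
| big_step_if: "big_step P env c v t1 \<Longrightarrow> big_step P env (if v \<noteq> Num 0 then e1 else e2) u t2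
    \<Longrightarrow> big_step P env (EIf c e1 e2) u (t1 + t2 + 1)"
| big_step_let: "big_step P env e1 v t1 \<Longrightarrow> big_step P (v # env) e2 u t2
    \<Longrightarrow> big_step P env (ELet e1 e2) u (t1 + t2 + 1)"
| big_step_call: "big_steps P env es vs t1 \<Longrightarrow> f < length P \<Longrightarrow> big_step P vs (P ! f) u t2
    \<Longrightarrow> big_step P env (ECall f es) u (t1 + t2 + 1)"
| big_steps_Nil: "big_steps P env [] [] 0"
| big_steps_Cons: "big_step P env e v t1 \<Longrightarrow> big_steps P env es vs t2
    \<Longrightarrow> big_steps P env (e # es) (v # vs) (t1 + t2)"

inductive_cases big_step_varE: "big_step P env (EVar i) v t"
inductive_cases big_step_litE: "big_step P env (ELit n) v t"
inductive_cases big_step_unE: "big_step P env (EUn f e) v t"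
inductive_cases big_step_binE: "big_step P env (EBin f e1 e2) v t"
inductive_cases big_step_ifE: "big_step P env (EIf c e1 e2) v t"
inductive_cases big_step_letE: "big_step P env (ELet e1 e2) v t"
inductive_cases big_step_callE: "big_step P env (ECall f es) v t"
inductive_cases big_steps_NilE: "big_steps P env [] vs t"
inductive_cases big_steps_ConsE: "big_steps P env (e # es) vs t"

lemma big_step_deterministic:
  "big_step P env e v t \<Longrightarrow> (\<forall>v' t'. big_step P env e v' t' \<longrightarrow> v' = v \<and> t' = t)"
  "big_steps P env es vs s \<Longrightarrow> (\<forall>vs' s'. big_steps P env es vs' s' \<longrightarrow> vs' = vs \<and> s' = s)"
proof (induction rule: big_step_big_steps.inducts)
  case (big_step_var i env) then show ?case by (blast elim: big_step_varE)
next
  case (big_step_lit env n) then show ?case by (auto elim: big_step_litE)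
next
  case (big_step_un env e v t f u)
  show ?case
  proof (intro allI impI)
    fix v' t' assume "big_step P env (EUn f e) v' t'"
    then obtain w s where "big_step P env e w s" "apply_unop f w = Some v'"
      "t' = s + val_size v'" by (rule big_step_unE)
    with big_step_un show "v' = u \<and> t' = t + val_size u" by (metis option.inject)
  qed
next
  case (big_step_bin env e1 v1 t1 e2 v2 t2 f u)
  show ?case
  proof (intro allI impI)
    fix v' t' assume "big_step P env (EBin f e1 e2) v' t'"
    then obtain w1 s1 w2 s2 where "big_step P env e1 w1 s1" "big_step P env e2 w2 s2"
      "apply_binop f w1 w2 = Some v'" "t' = s1 + s2 + val_size v'" by (rule big_step_binE)
    with big_step_bin show "v' = u \<and> t' = t1 + t2 + val_size u" by (metis option.inject)
  qed
next
  case (big_step_if env c v t1 e1 e2 u t2)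
  show ?case
  proof (intro allI impI)
    fix v' t' assume "big_step P env (EIf c e1 e2) v' t'"
    then obtain w s1 s2 where "big_step P env c w s1"
      "big_step P env (if w \<noteq> Num 0 then e1 else e2) v' s2" "t' = s1 + s2 + 1"
      by (rule big_step_ifE) (metis Suc_eq_plus1)
    with big_step_if.IH show "v' = u \<and> t' = t1 + t2 + 1" by metis
  qed
next
  case (big_step_let env e1 v t1 e2 u t2)
  then show ?case by (metis Suc_eq_plus1 big_step_letE)
next
  case (big_step_call env es vs t1 f u t2)
  then show ?case by (metis Suc_eq_plus1 big_step_callE)
next
  case (big_steps_Nil env) then show ?case by (blast elim: big_steps_NilE)
next
  case (big_steps_Cons env e v t1 es vs t2)
  then show ?case by (metis big_steps_ConsE)
qed

definition polytime_computable ::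
  "('a \<Rightarrow> val) \<Rightarrow> ('b \<Rightarrow> val) \<Rightarrow> 'a set \<Rightarrow> ('a \<Rightarrow> 'b) \<Rightarrow> bool" where
  "polytime_computable encA encB D f \<longleftrightarrow>
    (\<exists>(P :: program) (main :: expr) (p :: nat poly). \<forall>x\<in>D. \<exists>t.
      big_step P [encA x] main (encB (f x)) t \<and> t \<le> poly p (val_size (encA x)))"


section \<open>Max-r-Lin2-AA\<close>

record lin_eq =
  eq_vars :: "nat set"
  eq_rhs :: int
  eq_weight :: nat

record lin_inst =
  num_vars :: nat
  eqns :: "lin_eq list"
  par_k :: nat
  par_r :: nat

definition valid_inst :: "lin_inst \<Rightarrow> bool" where
  "valid_inst S \<longleftrightarrow> (\<forall>e\<in>set (eqns S).
     eq_vars e \<noteq> {} \<and> eq_vars e \<subseteq> {1..num_vars S} \<and> card (eq_vars e) \<le> par_r S \<and>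
     eq_rhs e \<in> {-1, 1} \<and> eq_weight e > 0)"

definition satisfies :: "(nat \<Rightarrow> int) \<Rightarrow> lin_eq \<Rightarrow> bool" where
  "satisfies x e \<longleftrightarrow> (\<Prod>i\<in>eq_vars e. x i) = eq_rhs e"

definition total_weight :: "lin_inst \<Rightarrow> nat" where
  "total_weight S = (\<Sum>e\<leftarrow>eqns S. eq_weight e)"

definition sat :: "lin_inst \<Rightarrow> nat" where
  "sat S = Max ((\<lambda>x. \<Sum>e\<leftarrow>filter (satisfies x) (eqns S). eq_weight e) `
     ({1..num_vars S} \<rightarrow>\<^sub>E {-1, 1}))"

definition yes_inst :: "lin_inst \<Rightarrow> bool" where
  "yes_inst S \<longleftrightarrow> real (sat S) \<ge> real (total_weight S) / 2 + real (par_k S)"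

primrec enc_list :: "val list \<Rightarrow> val" where
  "enc_list [] = Num 0"
| "enc_list (v # vs) = Pair v (enc_list vs)"

text \<open>The right-hand sides -1 and 1 are encoded by 0 and 1.\<close>

definition enc_eq :: "lin_eq \<Rightarrow> val" where
  "enc_eq e = enc_list [enc_list (map Num (sorted_list_of_set (eq_vars e))),
     Num (if eq_rhs e = 1 then 1 else 0), Num (eq_weight e)]"

definition enc_inst :: "lin_inst \<Rightarrow> val" where
  "enc_inst S = enc_list [Num (num_vars S), enc_list (map enc_eq (eqns S)),
     Num (par_k S), Num (par_r S)]"

end

theory Submission
  imports Defs
begin

text \<open>
  Encoding an equation by the set \<open>A\<close> of its variables, a system has excess
  (satisfied minus unsatisfied weight) \<open>\<Sum>A. c A * \<chi> A x\<close> with integer coefficients, and the question is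
  whether the excess reaches \<open>2 * k\<close>.  Let \<open>M\<close> be the family of sets with \<open>c A \<noteq> 0\<close>.  If the
  \<open>GF(2)\<close>-span of \<open>M\<close> contains a set \<open>Y\<close> with more than \<open>(2 * k - 1) * r\<close> elements, write \<open>Y\<close>
  as the sum of a subfamily \<open>T\<close> of \<open>M\<close> of least cardinality.  Then \<open>T\<close> has at least \<open>2 * k\<close> members,
  and by minimality no subfamily of \<open>T\<close> with two or more members sums to a member of \<open>M\<close>.  Hence in
  the average of the excess with weight \<open>\<Prod>A\<in>T. 1 + sgn (c A) * \<chi> A x\<close> exactly the terms
  \<open>\<bar>c A\<bar>\<close> for \<open>A \<in> T\<close> survive, so some assignment has excess at least \<open>2 * k\<close>.

  Gaussian elimination yields a set of pivot variables that is contained in a member \<open>Y\<close> of the span.  If there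
  are at most \<open>(2 * k - 1) * r\<close> pivots, setting every other variable to 1 is an equivalent
  instance; otherwise the answer is yes.
\<close>

section \<open>Polynomial-time combinators\<close>

text \<open>The number \<open>2 * k\<close> arises because twice the satisfied weight is the total
  weight plus the excess. The product weight vanishes unless every term of \<open>T\<close> is
  positive and is constant otherwise, so the average is the plain average over the assignments that
  make all of \<open>T\<close> positive; the other terms cancel there, because no subfamily of
  \<open>T\<close> sums to their variable set. Setting the non-pivots to 1 loses nothing because the
  pivot of a row occurs in no later row: from the last row to the first, flipping a pivot repairs
  its row without disturbing those already repaired. The same property puts all pivots into one span
  member. The obstacle is polynomial time, which has to be derived from an explicit cost semantics.
  Functions are assembled from combinators that carry code and a bound, and every loop needs a bound
  on the size of its intermediate values, since a cheap step could still double its accumulator in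
  each round.\<close>

definition polyb :: "(nat \<Rightarrow> nat) \<Rightarrow> bool" where
  "polyb b \<longleftrightarrow> (\<exists>p. b = poly p)"

lemma polyb_const: "polyb (\<lambda>_. c)"
  unfolding polyb_def by (rule exI[of _ "[:c:]"]) auto

lemma polyb_id: "polyb (\<lambda>n. n)"
  unfolding polyb_def by (rule exI[of _ "[:0, 1:]"]) auto

lemma polyb_add:
  assumes "polyb b" "polyb c"
  shows "polyb (\<lambda>n. b n + c n)"
proof -
  obtain p q where *: "b = poly p" "c = poly q" using assms unfolding polyb_def by blast
  have "(\<lambda>n. b n + c n) = poly (p + q)" by (rule ext) (simp only: poly_add *)
  then show ?thesis unfolding polyb_def by (rule exI)
qed

lemma polyb_mult:
  assumes "polyb b" "polyb c"
  shows "polyb (\<lambda>n. b n * c n)"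
proof -
  obtain p q where *: "b = poly p" "c = poly q" using assms unfolding polyb_def by blast
  have "(\<lambda>n. b n * c n) = poly (p * q)" by (rule ext) (simp only: poly_mult *)
  then show ?thesis unfolding polyb_def by (rule exI)
qed

lemmas polyb_intros = polyb_const polyb_id polyb_add polyb_mult

lemma polyb_compose:
  assumes "polyb b" "polyb c"
  shows "polyb (\<lambda>n. b (c n))"
proof -
  obtain p q where *: "b = poly p" "c = poly q" using assms unfolding polyb_def by blast
  have "(\<lambda>n. b (c n)) = poly (pcompose p q)" by (rule ext) (simp only: poly_pcompose *)
  then show ?thesis unfolding polyb_def by (rule exI)
qed

text \<open>Coefficients are natural numbers, so these bounds are monotone and a size may be
  replaced by an upper estimate inside them.\<close>

lemma poly_nat_mono: "m \<le> n \<Longrightarrow> poly (p :: nat poly) m \<le> poly p n"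
  by (induction p) (auto intro: add_mono mult_mono)

lemma polyb_mono: "polyb b \<Longrightarrow> m \<le> n \<Longrightarrow> b m \<le> b n"
  unfolding polyb_def using poly_nat_mono by blast

definition computes ::
  "program \<Rightarrow> nat \<Rightarrow> (nat \<Rightarrow> nat) \<Rightarrow> 'a set \<Rightarrow> ('a \<Rightarrow> val) \<Rightarrow> ('b \<Rightarrow> val) \<Rightarrow> ('a \<Rightarrow> 'b) \<Rightarrow> bool" where
  "computes P i b D eA eB f \<longleftrightarrow> i < length P \<and>
    (\<forall>x\<in>D. \<exists>t. big_step P [eA x] (P ! i) (eB (f x)) t \<and> t \<le> b (val_size (eA x)))"

text \<open>The surrounding code \<open>P0\<close> and \<open>Q\<close> is arbitrary, so that programs can be linked without
  renumbering calls.\<close>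

definition ptime :: "'a set \<Rightarrow> ('a \<Rightarrow> val) \<Rightarrow> ('b \<Rightarrow> val) \<Rightarrow> ('a \<Rightarrow> 'b) \<Rightarrow> bool" where
  "ptime D eA eB f \<longleftrightarrow>
    (\<exists>b. polyb b \<and> (\<forall>P0. \<exists>X i. \<forall>Q. computes (P0 @ X @ Q) i b D eA eB f))"

lemma computesD:
  assumes "computes P i b D eA eB f" "x \<in> D"
  obtains t where "big_step P [eA x] (P ! i) (eB (f x)) t" "t \<le> b (val_size (eA x))"
  using assms unfolding computes_def by blast

lemma computes_length: "computes P i b D eA eB f \<Longrightarrow> i < length P"
  unfolding computes_def by blast

text \<open>Linking without surrounding code gives a closed program; the body at the entry point
  serves as \<open>main\<close>, since it already expects its single argument as the
  environment.\<close>

lemma polytime_computableI: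
  assumes "ptime D eA eB f"
  shows "polytime_computable eA eB D f"
proof -
  obtain b where b: "polyb b" "\<forall>P0. \<exists>X i. \<forall>Q. computes (P0 @ X @ Q) i b D eA eB f"
    using assms unfolding ptime_def by blast
  then obtain X i where X: "\<forall>Q. computes ([] @ X @ Q) i b D eA eB f" by blast
  have c: "computes X i b D eA eB f" using X[rule_format, of "[]"] by simp
  obtain p where p: "b = poly p" using b(1) unfolding polyb_def by blast
  show ?thesis
    unfolding polytime_computable_def
    using c p unfolding computes_def by blast
qed

lemma val_size_pos [simp]: "0 < val_size v"
  by (cases v) auto

text \<open>Lookups, literals and primitives are charged the size of their result, and the other
  constructs pass on a value already paid for. A time bound is thus also a bound on the output size.
  The second clause only serves the mutual induction.\<close>

lemma val_size_le_cost:
  "big_step P env e v t \<Longrightarrow> val_size v \<le> t"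
  "big_steps P env es vs s \<Longrightarrow> True"
  by (induction rule: big_step_big_steps.inducts) auto

lemma ptime_size:
  assumes "ptime D eA eB f"
  shows "\<exists>b. polyb b \<and> (\<forall>x\<in>D. val_size (eB (f x)) \<le> b (val_size (eA x)))"
proof -
  obtain b where b: "polyb b" "\<forall>P0. \<exists>X i. \<forall>Q. computes (P0 @ X @ Q) i b D eA eB f"
    using assms unfolding ptime_def by blast
  then obtain X i where X: "\<forall>Q. computes ([] @ X @ Q) i b D eA eB f" by blast
  have c: "computes X i b D eA eB f" using X[rule_format, of "[]"] by simp
  show ?thesis
    using b(1) c unfolding computes_def by (meson val_size_le_cost(1) le_trans)
qed

text \<open>The linker: the code of up to three subroutines is laid out consecutively, each with the
  earlier code as its prefix, and one new body is appended. The body receives the entry points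
  \<open>i\<close>, \<open>j\<close>, \<open>k\<close> and its own position \<open>l\<close>, which
  permits recursion. Unneeded slots are filled by repeating a subroutine.\<close>

lemma ptime_build:
  assumes f: "ptime D1 eA1 eB1 f" and g: "ptime D2 eA2 eB2 g" and h: "ptime D3 eA3 eB3 h"
    and u: "\<And>b c d. polyb b \<Longrightarrow> polyb c \<Longrightarrow> polyb d \<Longrightarrow>
      \<exists>e. polyb e \<and> (\<forall>P i j k l. computes P i b D1 eA1 eB1 f \<longrightarrow> computes P j c D2 eA2 eB2 g \<longrightarrow>
        computes P k d D3 eA3 eB3 h \<longrightarrow> l < length P \<longrightarrow> P ! l = body i j k l \<longrightarrow>
        computes P l e D eA eB u)"
  shows "ptime D eA eB u"
proof -
  obtain b where b: "polyb b" "\<forall>P0. \<exists>X i. \<forall>Q. computes (P0 @ X @ Q) i b D1 eA1 eB1 f"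
    using f unfolding ptime_def by blast
  obtain c where c: "polyb c" "\<forall>P0. \<exists>X i. \<forall>Q. computes (P0 @ X @ Q) i c D2 eA2 eB2 g"
    using g unfolding ptime_def by blast
  obtain d where d: "polyb d" "\<forall>P0. \<exists>X i. \<forall>Q. computes (P0 @ X @ Q) i d D3 eA3 eB3 h"
    using h unfolding ptime_def by blast
  obtain e where e: "polyb e" "\<And>P i j k l. computes P i b D1 eA1 eB1 f \<Longrightarrow>
      computes P j c D2 eA2 eB2 g \<Longrightarrow> computes P k d D3 eA3 eB3 h \<Longrightarrow> l < length P \<Longrightarrow>
      P ! l = body i j k l \<Longrightarrow> computes P l e D eA eB u"
    using u[OF b(1) c(1) d(1)] by blast
  have "\<exists>X l. \<forall>Q. computes (P0 @ X @ Q) l e D eA eB u" for P0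
  proof -
    obtain X i where X: "\<And>Q. computes (P0 @ X @ Q) i b D1 eA1 eB1 f" using b(2) by blast
    obtain Y j where Y: "\<And>Q. computes ((P0 @ X) @ Y @ Q) j c D2 eA2 eB2 g" using c(2) by blast
    obtain Z k where Z: "\<And>Q. computes ((P0 @ X @ Y) @ Z @ Q) k d D3 eA3 eB3 h" using d(2) by blast
    let ?l = "length (P0 @ X @ Y @ Z)"
    have "computes (P0 @ (X @ Y @ Z @ [body i j k ?l]) @ Q) ?l e D eA eB u" for Q
    proof (rule e(2))
      show "computes (P0 @ (X @ Y @ Z @ [body i j k ?l]) @ Q) i b D1 eA1 eB1 f"
        using X[of "Y @ Z @ [body i j k ?l] @ Q"] by simp
      show "computes (P0 @ (X @ Y @ Z @ [body i j k ?l]) @ Q) j c D2 eA2 eB2 g"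
        using Y[of "Z @ [body i j k ?l] @ Q"] by simp
      show "computes (P0 @ (X @ Y @ Z @ [body i j k ?l]) @ Q) k d D3 eA3 eB3 h"
        using Z[of "[body i j k ?l] @ Q"] by simp
    qed (simp_all add: nth_append)
    then show ?thesis by blast
  qed
  with e(1) show ?thesis unfolding ptime_def by blast
qed

lemma big_step_call1:
  "big_step P env e v t \<Longrightarrow> f < length P \<Longrightarrow> big_step P [v] (P ! f) u s \<Longrightarrow>
    big_step P env (ECall f [e]) u (t + s + 1)"
  using big_step_call[OF big_steps_Cons[OF _ big_steps_Nil], of P env e v t f u s] by simp

lemma big_step_arg: "big_step P [v] (EVar 0) v (val_size v)"
  using big_step_var[of 0 "[v]" P] by simp

lemma big_step_call_arg:
  assumes "computes P i b D eA eB f" "x \<in> D"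
  obtains t where "big_step P [eA x] (ECall i [EVar 0]) (eB (f x)) t"
    "t \<le> val_size (eA x) + b (val_size (eA x)) + 1"
proof -
  obtain t where t: "big_step P [eA x] (P ! i) (eB (f x)) t" "t \<le> b (val_size (eA x))"
    using computesD[OF assms] .
  show ?thesis
    by (rule that[OF big_step_call1[OF big_step_arg computes_length[OF assms(1)] t(1)]]) (use t(2) in simp)
qed

section \<open>Size bounds for the primitive operations\<close>

lemma floorlog_add_le: "floorlog 2 (a + b) \<le> floorlog 2 a + floorlog 2 b"
proof (cases "a = 0 \<or> b = 0")
  case False
  have *: "x < 2 ^ floorlog 2 x" "2 \<le> (2::nat) ^ floorlog 2 x" if "x \<noteq> 0" for x :: nat
  proof -
    show "x < 2 ^ floorlog 2 x" using floorlog_bounds[of x 2] that by auto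
    have "1 \<le> floorlog 2 x" using floorlog_eq_zero_iff[of 2 x] that by linarith
    then show "2 \<le> (2::nat) ^ floorlog 2 x" using power_increasing[of 1 "floorlog 2 x" "2::nat"] by simp
  qed
  have pq: "p + q \<le> p * q" if "2 \<le> p" "2 \<le> q" for p q :: nat
  proof -
    have "p = (p - 2) + 2" "q = (q - 2) + 2" using that by auto
    then obtain u v where "p = u + 2" "q = v + 2" by blast
    then show ?thesis by simp
  qed
  have "a + b < 2 ^ floorlog 2 a + 2 ^ floorlog 2 b"
    using *(1)[of a] *(1)[of b] False by (intro add_strict_mono) auto
  also have "\<dots> \<le> 2 ^ (floorlog 2 a + floorlog 2 b)"
    using pq *(2)[of a] *(2)[of b] False by (simp add: power_add)
  finally show ?thesis by (rule floorlog_leI) auto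
qed auto

lemma floorlog_mult_le: "floorlog 2 (a * b) \<le> floorlog 2 a + floorlog 2 b"
proof (cases "a = 0 \<or> b = 0")
  case False
  then have "a < 2 ^ floorlog 2 a" "b < 2 ^ floorlog 2 b" using floorlog_bounds[of _ 2] by auto
  then have "a * b < 2 ^ (floorlog 2 a + floorlog 2 b)"
    by (simp add: power_add mult_strict_mono)
  then show ?thesis by (rule floorlog_leI) auto
qed auto

lemma val_size_bool: "val_size (Num (of_bool b)) \<le> 2"
  by (simp add: floorlog_def)

lemma apply_unop_size: "apply_unop f u = Some v \<Longrightarrow> val_size v \<le> val_size u + 1"
  by (induction f u rule: apply_unop.induct) (auto simp: floorlog_def)

lemma apply_binop_size: "apply_binop f u v = Some w \<Longrightarrow> val_size w \<le> val_size u + val_size v + 1"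
proof (induction f u v rule: apply_binop.induct)
  case (2 u v)
  have "w = Num (of_bool (u = v))" using 2 by simp
  then have "val_size w \<le> 2" by (simp only: val_size_bool)
  then show ?case using val_size_pos[of u] val_size_pos[of v] by linarith
next
  case (7 a b)
  have "w = Num (of_bool (a < b))" using 7 by simp
  then have "val_size w \<le> 2" by (simp only: val_size_bool)
  then show ?case using val_size_pos[of "Num a"] val_size_pos[of "Num b"] by linarith
next
  case (3 a b) then show ?case using floorlog_add_le[of a b] by auto
next
  case (4 a b) then show ?case using floorlog_mono[of "a - b" a 2] by auto
next
  case (5 a b) then show ?case using floorlog_mult_le[of a b] by auto
next
  case (6 a b) then show ?case using floorlog_mono[of "a div b" a 2] by auto
qed auto

section \<open>Closure of polynomial time under the basic constructs\<close>

lemma computesI: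
  "l < length P \<Longrightarrow>
    (\<And>x. x \<in> D \<Longrightarrow> \<exists>t. big_step P [eA x] (P ! l) (eB (f x)) t \<and> t \<le> b (val_size (eA x))) \<Longrightarrow>
    computes P l b D eA eB f"
  unfolding computes_def by blast

lemma ptime_mono: "ptime D eA eB f \<Longrightarrow> D' \<subseteq> D \<Longrightarrow> ptime D' eA eB f"
  unfolding ptime_def computes_def by (meson subsetD)

lemma ptime_UNIV: "ptime UNIV eA eB f \<Longrightarrow> ptime D eA eB f"
  by (rule ptime_mono) auto

lemma ptime_literal:
  assumes "\<And>x. x \<in> D \<Longrightarrow> eB (f x) = Num m"
  shows "ptime D eA eB f"
proof -
  define b where "b = (\<lambda>_ :: nat. val_size (Num m))"
  have "computes (P0 @ [ELit m] @ Q) (length P0) b D eA eB f" for P0 Q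
  proof (rule computesI)
    fix x assume "x \<in> D"
    then show "\<exists>t. big_step (P0 @ [ELit m] @ Q) [eA x] ((P0 @ [ELit m] @ Q) ! length P0) (eB (f x)) t
        \<and> t \<le> b (val_size (eA x))"
      unfolding b_def using assms[of x] big_step_lit[of "P0 @ [ELit m] @ Q" "[eA x]" m]
      by (intro exI[of _ "val_size (Num m)"]) simp
  qed simp
  moreover have "polyb b" unfolding b_def by (rule polyb_const)
  ultimately show ?thesis unfolding ptime_def by blast
qed

lemma ptime_id: "ptime D eA eA (\<lambda>x. x)"
proof -
  have "computes (P0 @ [EVar 0] @ Q) (length P0) (\<lambda>n. n) D eA eA (\<lambda>x. x)" for P0 Q
    by (rule computesI) (use big_step_arg in \<open>fastforce simp: nth_append\<close>)+
  then show ?thesis unfolding ptime_def using polyb_id by blast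
qed

lemma ptime_un:
  assumes f: "ptime D eA eB f"
    and u: "\<And>x. x \<in> D \<Longrightarrow> apply_unop u (eB (f x)) = Some (eC (h x))"
  shows "ptime D eA eC h"
proof (rule ptime_build[OF f f f, where body = "\<lambda>i _ _ _. EUn u (ECall i [EVar 0])"])
  fix b :: "nat \<Rightarrow> nat" assume b: "polyb b"
  show "\<exists>e. polyb e \<and> (\<forall>P i j k l. computes P i b D eA eB f \<longrightarrow> computes P j c D eA eB f \<longrightarrow>
        computes P k d D eA eB f \<longrightarrow> l < length P \<longrightarrow> P ! l = EUn u (ECall i [EVar 0]) \<longrightarrow>
        computes P l e D eA eC h)" for c d
  \<comment> \<open>The first summand bounds the call. The second bounds the charge for the result,
    whose size exceeds that of the operand, and hence the cost of the call, by at most 1.\<close>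
  proof (intro exI[of _ "\<lambda>n. (n + b n + 1) + (n + b n + 2)"] conjI allI impI)
    fix P i j k l
    assume f: "computes P i b D eA eB f" and l: "l < length P" "P ! l = EUn u (ECall i [EVar 0])"
    show "computes P l (\<lambda>n. (n + b n + 1) + (n + b n + 2)) D eA eC h"
    proof (rule computesI[OF l(1)])
      fix x assume x: "x \<in> D"
      obtain t where t: "big_step P [eA x] (ECall i [EVar 0]) (eB (f x)) t"
        "t \<le> val_size (eA x) + b (val_size (eA x)) + 1"
        by (rule big_step_call_arg[OF f x])
      show "\<exists>t. big_step P [eA x] (P ! l) (eC (h x)) t \<and> t \<le> val_size (eA x) + b (val_size (eA x)) + 1 +
          (val_size (eA x) + b (val_size (eA x)) + 2)"
        unfolding l(2)
        using big_step_un[OF t(1) u[OF x]] t(2) val_size_le_cost(1)[OF t(1)]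
          apply_unop_size[OF u[OF x]] by (intro exI conjI) (assumption, linarith)
    qed
  qed (intro polyb_intros b)
qed

lemma ptime_bin:
  assumes f: "ptime D eA eB f" and g: "ptime D eA eC g"
    and u: "\<And>x. x \<in> D \<Longrightarrow> apply_binop u (eB (f x)) (eC (g x)) = Some (eE (h x))"
  shows "ptime D eA eE h"
proof (rule ptime_build[OF f g f, where body = "\<lambda>i j _ _. EBin u (ECall i [EVar 0]) (ECall j [EVar 0])"])
  fix b c :: "nat \<Rightarrow> nat" assume b: "polyb b" and c: "polyb c"
  let ?e = "\<lambda>n. ((n + b n + 1) + (n + c n + 1)) + ((n + b n + 1) + (n + c n + 1) + 1)"
  show "\<exists>e. polyb e \<and> (\<forall>P i j k l. computes P i b D eA eB f \<longrightarrow> computes P j c D eA eC g \<longrightarrow>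
        computes P k d D eA eB f \<longrightarrow> l < length P \<longrightarrow>
        P ! l = EBin u (ECall i [EVar 0]) (ECall j [EVar 0]) \<longrightarrow> computes P l e D eA eE h)" for d
  proof (intro exI[of _ ?e] conjI allI impI)
    fix P i j k l
    assume f: "computes P i b D eA eB f" and g: "computes P j c D eA eC g"
      and l: "l < length P" "P ! l = EBin u (ECall i [EVar 0]) (ECall j [EVar 0])"
    show "computes P l ?e D eA eE h"
    proof (rule computesI[OF l(1)])
      fix x assume x: "x \<in> D"
      obtain t where t: "big_step P [eA x] (ECall i [EVar 0]) (eB (f x)) t"
        "t \<le> val_size (eA x) + b (val_size (eA x)) + 1"
        by (rule big_step_call_arg[OF f x])
      obtain s where s: "big_step P [eA x] (ECall j [EVar 0]) (eC (g x)) s"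
        "s \<le> val_size (eA x) + c (val_size (eA x)) + 1"
        by (rule big_step_call_arg[OF g x])
      show "\<exists>t. big_step P [eA x] (P ! l) (eE (h x)) t \<and> t \<le> ?e (val_size (eA x))"
        unfolding l(2)
        using big_step_bin[OF t(1) s(1) u[OF x]] t(2) s(2) val_size_le_cost(1)[OF t(1)]
          val_size_le_cost(1)[OF s(1)] apply_binop_size[OF u[OF x]]
        by (intro exI conjI) (assumption, linarith)
    qed
  qed (intro polyb_intros b c)+
qed

definition encB :: "bool \<Rightarrow> val" where "encB b = Num (of_bool b)"

definition encP :: "('a \<Rightarrow> val) \<Rightarrow> ('b \<Rightarrow> val) \<Rightarrow> 'a \<times> 'b \<Rightarrow> val" where
  "encP eA eB p = Pair (eA (fst p)) (eB (snd p))"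

definition encL :: "('a \<Rightarrow> val) \<Rightarrow> 'a list \<Rightarrow> val" where
  "encL e l = enc_list (map e l)"

text \<open>Each branch has to be computed only where it is taken, so partial operations can be
  guarded by a test.\<close>

lemma ptime_if:
  assumes f: "ptime D eA encB f" and g: "ptime (D \<inter> {x. f x}) eA eB g"
    and h: "ptime (D \<inter> {x. \<not> f x}) eA eB h"
  shows "ptime D eA eB (\<lambda>x. if f x then g x else h x)"
proof (rule ptime_build[OF f g h, where
      body = "\<lambda>i j k _. EIf (ECall i [EVar 0]) (ECall j [EVar 0]) (ECall k [EVar 0])"])
  fix b c d :: "nat \<Rightarrow> nat" assume b: "polyb b" and c: "polyb c" and d: "polyb d"
  let ?e = "\<lambda>n. ((n + b n + 1) + (n + c n + 1)) + ((n + d n + 1) + 1)"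
  let ?u = "\<lambda>x. if f x then g x else h x"
  show "\<exists>e. polyb e \<and> (\<forall>P i j k l. computes P i b D eA encB f \<longrightarrow>
        computes P j c (D \<inter> {x. f x}) eA eB g \<longrightarrow>
        computes P k d (D \<inter> {x. \<not> f x}) eA eB h \<longrightarrow> l < length P \<longrightarrow>
        P ! l = EIf (ECall i [EVar 0]) (ECall j [EVar 0]) (ECall k [EVar 0]) \<longrightarrow>
        computes P l e D eA eB ?u)"
  proof (intro exI[of _ ?e] conjI allI impI)
    fix P i j k l
    assume f: "computes P i b D eA encB f" and g: "computes P j c (D \<inter> {x. f x}) eA eB g"
      and h: "computes P k d (D \<inter> {x. \<not> f x}) eA eB h"
      and l: "l < length P" "P ! l = EIf (ECall i [EVar 0]) (ECall j [EVar 0]) (ECall k [EVar 0])"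
    show "computes P l ?e D eA eB ?u"
    proof (rule computesI[OF l(1)])
      fix x assume x: "x \<in> D"
      obtain t where t: "big_step P [eA x] (ECall i [EVar 0]) (encB (f x)) t"
        "t \<le> val_size (eA x) + b (val_size (eA x)) + 1"
        by (rule big_step_call_arg[OF f x])
      show "\<exists>t. big_step P [eA x] (P ! l) (eB (?u x)) t \<and> t \<le> ?e (val_size (eA x))"
      proof (cases "f x")
        case True
        obtain s where s: "big_step P [eA x] (ECall j [EVar 0]) (eB (g x)) s"
          "s \<le> val_size (eA x) + c (val_size (eA x)) + 1"
          by (rule big_step_call_arg[OF g]) (use x True in auto)
        have "big_step P [eA x] (P ! l) (eB (?u x)) (t + s + 1)"
          unfolding l(2) by (rule big_step_if[OF t(1)]) (use s True in \<open>simp add: encB_def\<close>)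
        then show ?thesis using t(2) s(2) by (intro exI conjI) (assumption, linarith)
      next
        case False
        obtain s where s: "big_step P [eA x] (ECall k [EVar 0]) (eB (h x)) s"
          "s \<le> val_size (eA x) + d (val_size (eA x)) + 1"
          by (rule big_step_call_arg[OF h]) (use x False in auto)
        have "big_step P [eA x] (P ! l) (eB (?u x)) (t + s + 1)"
          unfolding l(2) by (rule big_step_if[OF t(1)]) (use s False in \<open>simp add: encB_def\<close>)
        then show ?thesis using t(2) s(2) by (intro exI conjI) (assumption, linarith)
      qed
    qed
  qed (intro polyb_intros b c d)+
qed

lemma ptime_comp:
  assumes g: "ptime D' eB eC g" and f: "ptime D eA eB f" and D: "\<And>x. x \<in> D \<Longrightarrow> f x \<in> D'"
  shows "ptime D eA eC (\<lambda>x. g (f x))"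
proof (rule ptime_build[OF f g f, where body = "\<lambda>i j _ _. ECall j [ECall i [EVar 0]]"])
  fix b c :: "nat \<Rightarrow> nat" assume b: "polyb b" and c: "polyb c"
  let ?e = "\<lambda>n. (n + b n + 1) + c (n + b n + 1) + 1"
  show "\<exists>e. polyb e \<and> (\<forall>P i j k l. computes P i b D eA eB f \<longrightarrow> computes P j c D' eB eC g \<longrightarrow>
        computes P k d D eA eB f \<longrightarrow> l < length P \<longrightarrow>
        P ! l = ECall j [ECall i [EVar 0]] \<longrightarrow> computes P l e D eA eC (\<lambda>x. g (f x)))" for d
  proof (intro exI[of _ ?e] conjI allI impI)
    fix P i j k l
    assume f: "computes P i b D eA eB f" and g: "computes P j c D' eB eC g"
      and l: "l < length P" "P ! l = ECall j [ECall i [EVar 0]]"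
    show "computes P l ?e D eA eC (\<lambda>x. g (f x))"
    proof (rule computesI[OF l(1)])
      fix x assume x: "x \<in> D"
      obtain t where t: "big_step P [eA x] (ECall i [EVar 0]) (eB (f x)) t"
        "t \<le> val_size (eA x) + b (val_size (eA x)) + 1"
        by (rule big_step_call_arg[OF f x])
      obtain s where s: "big_step P [eB (f x)] (P ! j) (eC (g (f x))) s"
        "s \<le> c (val_size (eB (f x)))"
        by (rule computesD[OF g D[OF x]])
      \<comment> \<open>The input of \<open>g\<close> is the output of the call of \<open>f\<close>,
        so its size is at most the cost of that call; monotonicity of \<open>c\<close> does the
        rest.\<close>
      have "s \<le> c (val_size (eA x) + b (val_size (eA x)) + 1)"
        by (rule order_trans[OF s(2)], rule polyb_mono[OF c])
          (use t(2) val_size_le_cost(1)[OF t(1)] in linarith)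
      then show "\<exists>t. big_step P [eA x] (P ! l) (eC (g (f x))) t \<and> t \<le> ?e (val_size (eA x))"
        unfolding l(2)
        using big_step_call1[OF t(1) computes_length[OF g] s(1)] t(2)
        by (intro exI conjI) (assumption, linarith)
    qed
  qed (intro polyb_add polyb_const polyb_id b c polyb_compose[OF c])+
qed

lemma ptime_app:
  "ptime UNIV eB eC g \<Longrightarrow> ptime D eA eB f \<Longrightarrow> ptime D eA eC (\<lambda>x. g (f x))"
  by (rule ptime_comp) auto

lemma ptime_Pair:
  "ptime D eA eB f \<Longrightarrow> ptime D eA eC g \<Longrightarrow> ptime D eA (encP eB eC) (\<lambda>x. (f x, g x))"
  by (erule (1) ptime_bin[where u = MkPair]) (simp add: encP_def)

lemma ptime_fst: "ptime D eA (encP eB eC) f \<Longrightarrow> ptime D eA eB (\<lambda>x. fst (f x))"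
  by (erule ptime_un[where u = Fst]) (simp add: encP_def)

lemma ptime_snd: "ptime D eA (encP eB eC) f \<Longrightarrow> ptime D eA eC (\<lambda>x. snd (f x))"
  by (erule ptime_un[where u = Snd]) (simp add: encP_def)

lemma ptime_nat: "ptime D eA Num (\<lambda>_. m)"
  by (rule ptime_literal) simp

lemma ptime_bool: "ptime D eA encB (\<lambda>_. m)"
  by (rule ptime_literal) (simp add: encB_def)

lemma ptime_Nil: "ptime D eA (encL eB) (\<lambda>_. [])"
  by (rule ptime_literal[where m = 0]) (simp add: encL_def)

lemma ptime_Cons:
  "ptime D eA eB f \<Longrightarrow> ptime D eA (encL eB) g \<Longrightarrow> ptime D eA (encL eB) (\<lambda>x. f x # g x)"
  by (erule (1) ptime_bin[where u = MkPair]) (simp add: encL_def)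

lemma ptime_plus: "ptime D eA Num f \<Longrightarrow> ptime D eA Num g \<Longrightarrow> ptime D eA Num (\<lambda>x. f x + g x)"
  by (erule (1) ptime_bin[where u = Plus]) simp

lemma ptime_minus: "ptime D eA Num f \<Longrightarrow> ptime D eA Num g \<Longrightarrow> ptime D eA Num (\<lambda>x. f x - g x)"
  by (erule (1) ptime_bin[where u = Minus]) simp

lemma ptime_times: "ptime D eA Num f \<Longrightarrow> ptime D eA Num g \<Longrightarrow> ptime D eA Num (\<lambda>x. f x * g x)"
  by (erule (1) ptime_bin[where u = Times]) simp

lemma ptime_less: "ptime D eA Num f \<Longrightarrow> ptime D eA Num g \<Longrightarrow> ptime D eA encB (\<lambda>x. f x < g x)"
  by (erule (1) ptime_bin[where u = Less]) (simp add: encB_def)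

lemma ptime_eq:
  "inj eB \<Longrightarrow> ptime D eA eB f \<Longrightarrow> ptime D eA eB g \<Longrightarrow> ptime D eA encB (\<lambda>x. f x = g x)"
  by (erule (1) ptime_bin[where u = Equal]) (simp add: encB_def inj_eq)

lemma ptime_not:
  assumes "ptime D eA encB f"
  shows "ptime D eA encB (\<lambda>x. \<not> f x)"
proof -
  have "ptime D eA encB (\<lambda>x. if f x then False else True)"
    by (intro ptime_if assms ptime_bool)
  also have "(\<lambda>x. if f x then False else True) = (\<lambda>x. \<not> f x)" by auto
  finally show ?thesis .
qed

lemma ptime_conj:
  assumes "ptime D eA encB f" "ptime D eA encB g"
  shows "ptime D eA encB (\<lambda>x. f x \<and> g x)"
proof -
  have "ptime D eA encB (\<lambda>x. if f x then g x else False)"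
    by (intro ptime_if assms ptime_bool ptime_mono[OF assms(2)]) auto
  also have "(\<lambda>x. if f x then g x else False) = (\<lambda>x. f x \<and> g x)" by auto
  finally show ?thesis .
qed

lemma ptime_null:
  assumes "ptime D eA (encL eB) f"
  shows "ptime D eA encB (\<lambda>x. f x = [])"
proof -
  have "apply_unop IsPair (encL eB l) = Some (encB (l \<noteq> []))" for l
    by (cases l) (auto simp: encL_def encB_def)
  then have "ptime D eA encB (\<lambda>x. f x \<noteq> [])"
    by (intro ptime_un[OF assms, where u = IsPair])
  from ptime_not[OF this] show ?thesis by simp
qed

lemma inj_Num: "inj Num"
  by (rule injI) simp

lemma inj_encL:
  assumes "inj e"
  shows "inj (encL e)"
proof (rule injI)
  show "l = m" if "encL e l = encL e m" for l m
    using that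
  proof (induction l arbitrary: m)
    case Nil
    then show ?case by (cases m) (auto simp: encL_def)
  next
    case (Cons a l)
    then show ?case using assms by (cases m) (auto simp: encL_def inj_eq)
  qed
qed

lemma ptime_hd:
  assumes "ptime D eA (encL Num) f"
  shows "ptime D eA Num (\<lambda>x. hd (f x))"
proof -
  have "ptime (D \<inter> {x. f x \<noteq> []}) eA Num (\<lambda>x. hd (f x))"
    by (rule ptime_un[OF ptime_mono[OF assms], where u = Fst]) (auto simp: encL_def neq_Nil_conv)
  \<comment> \<open>\<open>hd []\<close> is unspecified but a fixed number, so the program can
    return it as a literal and the combinator needs no side condition.\<close>
  then have "ptime D eA Num (\<lambda>x. if f x = [] then hd [] else hd (f x))"
    by (intro ptime_if ptime_null[OF assms] ptime_nat)
  also have "(\<lambda>x. if f x = [] then hd [] else hd (f x)) = (\<lambda>x. hd (f x))" by auto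
  finally show ?thesis .
qed

section \<open>Loops over lists\<close>

lemma val_size_encL: "val_size (encL e l) = (\<Sum>a\<leftarrow>l. 1 + val_size (e a)) + 1"
  by (induction l) (auto simp: encL_def floorlog_def)

lemma length_le_val_size: "length l < val_size (encL e l)"
  by (induction l) (auto simp: encL_def floorlog_def)

text \<open>The argument of the loop is the triple of the remaining list, the accumulator and a parameter.\<close>

definition loop_body :: "nat \<Rightarrow> nat \<Rightarrow> expr" where
  "loop_body i l = EIf (EUn IsPair (EUn Fst (EVar 0)))
    (ECall l [EBin MkPair (EUn Snd (EUn Fst (EVar 0)))
      (EBin MkPair (ECall i [EBin MkPair (EUn Fst (EUn Fst (EVar 0))) (EUn Snd (EVar 0))])
        (EUn Snd (EUn Snd (EVar 0))))])
    (EUn Fst (EUn Snd (EVar 0)))"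

text \<open>\<open>M\<close> bounds every value handled. One round charges 17 such values, three
  single units and one run of the step function at cost at most \<open>b M\<close>, which gives
  \<open>20 * M + b M\<close>. The extra \<open>1\<close> in the number of rounds pays for returning
  the accumulator at the end of the list.\<close>

lemma loop_cost:
  assumes step: "computes P i b UNIV (encP eB (encP eS eA)) eS (\<lambda>y. f (fst y) (fst (snd y)) (snd (snd y)))"
    and b: "polyb b" and l: "l < length P" "P ! l = loop_body i l"
    and bound: "\<And>us vs. zs = us @ vs \<Longrightarrow> val_size (eS (foldl (\<lambda>s a. f a s x) s us)) \<le> S"
    and M: "val_size (encL eB zs) + S + val_size (eA x) + 2 \<le> M"
  shows "\<exists>t. big_step P [encP (encL eB) (encP eS eA) (zs, s, x)] (P ! l)
      (eS (foldl (\<lambda>s a. f a s x) s zs)) t \<and> t \<le> (length zs + 1) * (20 * M + b M)"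
  using bound M
proof (induction zs arbitrary: s)
  case Nil
  have S: "val_size (eS s) \<le> S" using Nil(1)[of "[]" "[]"] by simp
  let ?v = "Pair (encL eB []) (Pair (eS s) (eA x))"
  note v = big_step_arg[of P ?v]
  have "big_step P [?v] (EUn IsPair (EUn Fst (EVar 0))) (Num 0)
      (val_size ?v + val_size (encL eB []) + val_size (Num 0))"
    by (intro big_step_un[OF big_step_un[OF v]]) (auto simp: encL_def)
  moreover have "big_step P [?v] (EUn Fst (EUn Snd (EVar 0))) (eS s)
      (val_size ?v + val_size (Pair (eS s) (eA x)) + val_size (eS s))"
    by (intro big_step_un[OF big_step_un[OF v]]) auto
  ultimately have "big_step P [?v] (P ! l) (eS s) ((val_size ?v + val_size (encL eB []) + val_size (Num 0))
      + (val_size ?v + val_size (Pair (eS s) (eA x)) + val_size (eS s)) + 1)"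
    unfolding l loop_body_def by (intro big_step_if) auto
  then show ?case using S Nil(2)
    by (intro exI conjI) (simp add: encP_def, simp add: encL_def floorlog_def)
next
  case (Cons a zs)
  let ?F = "\<lambda>s a. f a s x"
  let ?Z = "encL eB zs"
  let ?aZ = "Pair (eB a) ?Z"
  let ?sx = "Pair (eS s) (eA x)"
  let ?v = "Pair ?aZ ?sx"
  let ?s = "eS (f a s x)"
  let ?w = "Pair ?Z (Pair ?s (eA x))"
  have aZ: "encL eB (a # zs) = ?aZ" by (simp add: encL_def)
  have S: "val_size (eS s) \<le> S" "val_size ?s \<le> S"
    using Cons(2)[of "[]" "a # zs"] Cons(2)[of "[a]" zs] by auto
  obtain r where r: "big_step P [?w] (P ! l) (eS (foldl ?F (f a s x) zs)) r"
    "r \<le> (length zs + 1) * (20 * M + b M)"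
  proof -
    have "val_size (eS (foldl ?F (f a s x) us)) \<le> S" if "zs = us @ vs" for us vs
      using Cons(2)[of "a # us" vs] that by simp
    moreover have "val_size (encL eB zs) + S + val_size (eA x) + 2 \<le> M"
      using Cons(3) unfolding aZ by simp
    ultimately show thesis using Cons(1)[of "f a s x"] that by (auto simp: encP_def)
  qed
  note v = big_step_arg[of P ?v]
  have zx: "big_step P [?v] (EUn Fst (EVar 0)) ?aZ (val_size ?v + val_size ?aZ)"
    by (intro big_step_un[OF v]) auto
  have sx: "big_step P [?v] (EUn Snd (EVar 0)) ?sx (val_size ?v + val_size ?sx)"
    by (intro big_step_un[OF v]) auto
  have 1: "big_step P [?v] (EUn IsPair (EUn Fst (EVar 0))) (Num 1)
      (val_size ?v + val_size ?aZ + val_size (Num 1))"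
    by (intro big_step_un[OF zx]) auto
  have 2: "big_step P [?v] (EUn Snd (EUn Fst (EVar 0))) ?Z (val_size ?v + val_size ?aZ + val_size ?Z)"
    by (intro big_step_un[OF zx]) auto
  have 3: "big_step P [?v] (EUn Fst (EUn Fst (EVar 0))) (eB a) (val_size ?v + val_size ?aZ + val_size (eB a))"
    by (intro big_step_un[OF zx]) auto
  have 4: "big_step P [?v] (EUn Snd (EUn Snd (EVar 0))) (eA x) (val_size ?v + val_size ?sx + val_size (eA x))"
    by (intro big_step_un[OF sx]) auto
  let ?y = "Pair (eB a) ?sx"
  obtain u where u: "big_step P [?y] (P ! i) ?s u" "u \<le> b (val_size ?y)"
    using computesD[OF step, of "(a, s, x)"] by (auto simp: encP_def)
  have "val_size ?y \<le> M" using Cons(3) S unfolding aZ by simp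
  then have u': "u \<le> b M" using u(2) polyb_mono[OF b] by (meson le_trans)
  note 5 = big_step_call1[OF big_step_bin[OF 3 sx apply_binop.simps(1)] computes_length[OF step] u(1)]
  note 6 = big_step_bin[OF 2 big_step_bin[OF 5 4 apply_binop.simps(1)] apply_binop.simps(1)]
  note 7 = big_step_call1[OF 6 l(1) r(1)]
  \<comment> \<open>Both branches are named so that simplification can evaluate the test on
    \<open>Num 1\<close> and select the recursive call.\<close>
  note 8 = big_step_if[OF 1, where ?e1.0 = "ECall l [EBin MkPair (EUn Snd (EUn Fst (EVar 0)))
      (EBin MkPair (ECall i [EBin MkPair (EUn Fst (EUn Fst (EVar 0))) (EUn Snd (EVar 0))])
        (EUn Snd (EUn Snd (EVar 0))))]" and ?e2.0 = "EUn Fst (EUn Snd (EVar 0))", simplified, OF 7[simplified]]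
  have e: "foldl ?F s (a # zs) = foldl ?F (f a s x) zs" by simp
  have n: "floorlog 2 (Suc 0) = 1" by (simp add: floorlog_def)
  have big: "(length (a # zs) + 1) * (20 * M + b M) = (20 * M + b M) + (length zs + 1) * (20 * M + b M)"
    by simp
  show ?case
    unfolding e big unfolding encP_def aZ fst_conv snd_conv
    by (intro exI conjI, subst l(2), unfold loop_body_def, rule 8)
      (use r(2) u' S Cons(3)[unfolded aZ] n in \<open>simp\<close>)
qed

lemmas ptime_rules = ptime_id ptime_Pair ptime_fst ptime_snd

text \<open>A polynomial step does not suffice, since iterating it may let the accumulator grow
  exponentially; hence the size bound for the fold over every prefix.\<close>

lemma ptime_foldl:
  assumes step: "ptime UNIV (encP eB (encP eS eA)) eS (\<lambda>y. f (fst y) (fst (snd y)) (snd (snd y)))"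
    and init: "ptime D eA eS init" and lst: "ptime D eA (encL eB) lst"
    and q: "polyb q"
    and bound: "\<And>x us vs. x \<in> D \<Longrightarrow> lst x = us @ vs \<Longrightarrow>
      val_size (eS (foldl (\<lambda>s a. f a s x) (init x) us)) \<le> q (val_size (eA x))"
  shows "ptime D eA eS (\<lambda>x. foldl (\<lambda>s a. f a s x) (init x) (lst x))"
proof -
  \<comment> \<open>The reachable loop states: the accumulator is the fold over the part of the list
    already consumed. Only for these is the size bound known.\<close>
  define E where "E = {(zs, s, x). x \<in> D \<and>
    (\<exists>ys. lst x = ys @ zs \<and> s = foldl (\<lambda>s a. f a s x) (init x) ys)}"
  let ?e = "encP (encL eB) (encP eS eA)"
  let ?h = "\<lambda>y. foldl (\<lambda>s a. f a s (snd (snd y))) (fst (snd y)) (fst y)"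
  have "ptime E ?e eS ?h"
  proof (rule ptime_build[OF step step step, where body = "\<lambda>i _ _ l. loop_body i l"])
    fix b c d :: "nat \<Rightarrow> nat" assume b: "polyb b"
    \<comment> \<open>A state of size \<open>n\<close> contains the remaining list and the
      parameter, and its accumulators stay below \<open>q n\<close>, so \<open>n + q n + 2\<close>
      can serve as \<open>M\<close> in \<open>loop_cost\<close>; there are at most
      \<open>n + 1\<close> rounds.\<close>
    let ?c = "\<lambda>n. (n + 1) * (20 * (n + q n + 2) + b (n + q n + 2))"
    show "\<exists>e. polyb e \<and> (\<forall>P i j k l.
      computes P i b UNIV (encP eB (encP eS eA)) eS (\<lambda>y. f (fst y) (fst (snd y)) (snd (snd y))) \<longrightarrow>
      computes P j c UNIV (encP eB (encP eS eA)) eS (\<lambda>y. f (fst y) (fst (snd y)) (snd (snd y))) \<longrightarrow>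
      computes P k d UNIV (encP eB (encP eS eA)) eS (\<lambda>y. f (fst y) (fst (snd y)) (snd (snd y))) \<longrightarrow>
      l < length P \<longrightarrow> P ! l = loop_body i l \<longrightarrow> computes P l e E ?e eS ?h)"
    proof (intro exI[of _ ?c] conjI allI impI)
      fix P i j k l
      assume i: "computes P i b UNIV (encP eB (encP eS eA)) eS (\<lambda>y. f (fst y) (fst (snd y)) (snd (snd y)))"
        and l: "l < length P" "P ! l = loop_body i l"
      show "computes P l ?c E ?e eS ?h"
      proof (rule computesI[OF l(1)])
        fix y assume "y \<in> E"
        then obtain zs s x ys where y: "y = (zs, s, x)" and x: "x \<in> D"
          and ys: "lst x = ys @ zs" "s = foldl (\<lambda>s a. f a s x) (init x) ys"
          unfolding E_def by auto
        let ?n = "val_size (?e y)"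
        have n: "val_size (encL eB zs) + val_size (eA x) \<le> ?n" unfolding y by (simp add: encP_def)
        have *: "val_size (eS (foldl (\<lambda>s a. f a s x) s us)) \<le> q ?n" if "zs = us @ vs" for us vs
        proof -
          have "val_size (eS (foldl (\<lambda>s a. f a s x) s us)) \<le> q (val_size (eA x))"
            using bound[OF x, of "ys @ us" vs] ys that by simp
          also have "\<dots> \<le> q ?n" using n by (intro polyb_mono[OF q]) simp
          finally show ?thesis .
        qed
        have "val_size (encL eB zs) + q ?n + val_size (eA x) + 2 \<le> ?n + q ?n + 2" using n by simp
        then have "\<exists>t. big_step P [?e (zs, s, x)] (P ! l) (eS (foldl (\<lambda>s a. f a s x) s zs)) t \<and>
            t \<le> (length zs + 1) * (20 * (?n + q ?n + 2) + b (?n + q ?n + 2))"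
          by (rule loop_cost[OF i b l, rotated]) (rule *)
        then obtain t where t: "big_step P [?e (zs, s, x)] (P ! l) (eS (foldl (\<lambda>s a. f a s x) s zs)) t"
          "t \<le> (length zs + 1) * (20 * (?n + q ?n + 2) + b (?n + q ?n + 2))" by blast
        have "length zs \<le> ?n" using length_le_val_size[of zs eB] n by linarith
        then have "t \<le> ?c ?n" using t(2) by (meson add_le_mono1 le_trans mult_le_mono1)
        with t(1) show "\<exists>t. big_step P [?e y] (P ! l) (eS (?h y)) t \<and> t \<le> ?c ?n"
          unfolding y by auto
      qed
    qed (intro polyb_add polyb_mult polyb_const polyb_id q polyb_compose[OF b])+
  qed
  from ptime_comp[OF this ptime_Pair[OF lst ptime_Pair[OF init ptime_id]]]
  show ?thesis unfolding E_def by auto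
qed

lemma foldl_Cons_rev: "foldl (\<lambda>s a. g a # s) t l = rev (map g l) @ t"
  by (induction l arbitrary: t) auto

text \<open>If a round adds at most an amount that depends on the parameter alone, the accumulator
  grows at most by that amount times the length of the list, which is polynomial.\<close>

lemma ptime_foldl_linear:
  assumes step: "ptime UNIV (encP eB (encP eS eA)) eS (\<lambda>y. f (fst y) (fst (snd y)) (snd (snd y)))"
    and init: "ptime D eA eS init" and lst: "ptime D eA (encL eB) lst"
    and q: "polyb q"
    and grow: "\<And>x a s. x \<in> D \<Longrightarrow> a \<in> set (lst x) \<Longrightarrow>
      val_size (eS (f a s x)) \<le> val_size (eS s) + q (val_size (eA x))"
  shows "ptime D eA eS (\<lambda>x. foldl (\<lambda>s a. f a s x) (init x) (lst x))"
proof -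
  obtain b where b: "polyb b" "\<And>x. x \<in> D \<Longrightarrow> val_size (eS (init x)) \<le> b (val_size (eA x))"
    using ptime_size[OF init] by blast
  obtain c where c: "polyb c" "\<And>x. x \<in> D \<Longrightarrow> val_size (encL eB (lst x)) \<le> c (val_size (eA x))"
    using ptime_size[OF lst] by blast
  show ?thesis
  proof (rule ptime_foldl[OF step init lst])
    show "polyb (\<lambda>n. b n + c n * q n)" by (intro polyb_intros b c q)
    fix x us vs assume x: "x \<in> D" and l: "lst x = us @ vs"
    have "val_size (eS (foldl (\<lambda>s a. f a s x) s us)) \<le> val_size (eS s) + length us * q (val_size (eA x))"
      if "set us \<subseteq> set (lst x)" for s
      using that
    proof (induction us arbitrary: s)
      case (Cons a us)
      then have "val_size (eS (foldl (\<lambda>s a. f a s x) (f a s x) us))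
          \<le> val_size (eS (f a s x)) + length us * q (val_size (eA x))" by simp
      with grow[OF x, of a s] Cons(2) show ?case by simp
    qed simp
    from this[of "init x"] l have "val_size (eS (foldl (\<lambda>s a. f a s x) (init x) us))
        \<le> val_size (eS (init x)) + length us * q (val_size (eA x))" by simp
    moreover have "length us \<le> c (val_size (eA x))"
      using length_le_val_size[of "lst x" eB] c(2)[OF x] l by simp
    ultimately show "val_size (eS (foldl (\<lambda>s a. f a s x) (init x) us))
        \<le> b (val_size (eA x)) + c (val_size (eA x)) * q (val_size (eA x))"
      using b(2)[OF x] by (meson add_le_mono le_trans mult_le_mono1)
  qed
qed

lemma sum_list_member_le: "a \<in> set l \<Longrightarrow> g a \<le> (\<Sum>a\<leftarrow>l. g a :: nat)"
  by (rule member_le_sum_list) auto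

lemma val_size_member: "a \<in> set l \<Longrightarrow> val_size (e a) < val_size (encL e l)"
  unfolding val_size_encL using sum_list_member_le[of a l "\<lambda>a. 1 + val_size (e a)"] by simp

text \<open>Consing onto an accumulator reverses the list. With an arbitrary start value
  \<open>h x\<close>, reversal, append and map all become special cases.\<close>

lemma ptime_rev_map:
  assumes g: "ptime UNIV (encP eB eA) eC (\<lambda>y. g (fst y) (snd y))"
    and lst: "ptime D eA (encL eB) lst" and h: "ptime D eA (encL eC) h"
  shows "ptime D eA (encL eC) (\<lambda>x. rev (map (\<lambda>a. g a x) (lst x)) @ h x)"
proof -
  obtain b where b: "polyb b" "\<And>y. val_size (eC (g (fst y) (snd y))) \<le> b (val_size (encP eB eA y))"
    using ptime_size[OF g] by auto
  obtain c where c: "polyb c" "\<And>x. x \<in> D \<Longrightarrow> val_size (encL eB (lst x)) \<le> c (val_size (eA x))"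
    using ptime_size[OF lst] by blast
  have "ptime D eA (encL eC) (\<lambda>x. foldl (\<lambda>s a. g a x # s) (h x) (lst x))"
  proof (rule ptime_foldl_linear[OF _ h lst])
    \<comment> \<open>The projections of an explicit pair display the term as \<open>g\<close>
      applied to a rearranged argument, the shape \<open>ptime_app\<close> produces; simplification
      removes them afterwards.\<close>
    have "ptime UNIV (encP eB (encP (encL eC) eA)) eC (\<lambda>y. g (fst (fst y, snd (snd y))) (snd (fst y, snd (snd y))))"
      by (rule ptime_app[OF g]) (rule ptime_rules)+
    then show "ptime UNIV (encP eB (encP (encL eC) eA)) (encL eC)
        (\<lambda>y. g (fst y) (snd (snd y)) # fst (snd y))"
      by (intro ptime_Cons) (simp, (rule ptime_rules)+)
    show "polyb (\<lambda>n. b (c n + n + 1) + 1)"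
      by (intro polyb_compose[OF b(1)] polyb_intros c)
    fix x a s assume x: "x \<in> D" and a: "a \<in> set (lst x)"
    have "val_size (encP eB eA (a, x)) \<le> c (val_size (eA x)) + val_size (eA x) + 1"
      using val_size_member[OF a, of eB] c(2)[OF x] by (simp add: encP_def)
    then have "val_size (eC (g a x)) \<le> b (c (val_size (eA x)) + val_size (eA x) + 1)"
      using b(2)[of "(a, x)"] polyb_mono[OF b(1)] by (metis fst_conv snd_conv le_trans)
    then show "val_size (encL eC (g a x # s))
        \<le> val_size (encL eC s) + (b (c (val_size (eA x)) + val_size (eA x) + 1) + 1)"
      by (simp add: encL_def)
  qed
  then show ?thesis by (simp add: foldl_Cons_rev)
qed

lemma ptime_rev:
  assumes "ptime D eA (encL eB) f"
  shows "ptime D eA (encL eB) (\<lambda>x. rev (f x))"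
  using ptime_rev_map[where g = "\<lambda>a _. a" and h = "\<lambda>_. []", OF ptime_fst[OF ptime_id] assms ptime_Nil] by simp

lemma ptime_append:
  assumes "ptime D eA (encL eB) f" "ptime D eA (encL eB) g"
  shows "ptime D eA (encL eB) (\<lambda>x. f x @ g x)"
  using ptime_rev_map[where g = "\<lambda>a _. a" and h = g, OF ptime_fst[OF ptime_id] ptime_rev[OF assms(1)] assms(2)]
  by simp

lemma ptime_map:
  assumes g: "ptime UNIV (encP eB eA) eC (\<lambda>y. g (fst y) (snd y))"
    and lst: "ptime D eA (encL eB) lst"
  shows "ptime D eA (encL eC) (\<lambda>x. map (\<lambda>a. g a x) (lst x))"
  using ptime_rev_map[OF g ptime_rev[OF lst] ptime_Nil] by (simp add: rev_map)

lemma ptime_filter: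
  assumes g: "ptime UNIV (encP eB eA) encB (\<lambda>y. g (fst y) (snd y))"
    and lst: "ptime D eA (encL eB) lst"
  shows "ptime D eA (encL eB) (\<lambda>x. filter (\<lambda>a. g a x) (lst x))"
proof -
  obtain c where c: "polyb c" "\<And>x. x \<in> D \<Longrightarrow> val_size (encL eB (lst x)) \<le> c (val_size (eA x))"
    using ptime_size[OF lst] by blast
  have "ptime D eA (encL eB) (\<lambda>x. foldl (\<lambda>s a. if g a x then a # s else s) [] (lst x))"
  proof (rule ptime_foldl_linear[OF _ ptime_Nil lst c(1)])
    have "ptime UNIV (encP eB (encP (encL eB) eA)) encB (\<lambda>y. g (fst (fst y, snd (snd y))) (snd (fst y, snd (snd y))))"
      by (rule ptime_app[OF g]) (rule ptime_rules)+
    then show "ptime UNIV (encP eB (encP (encL eB) eA)) (encL eB)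
        (\<lambda>y. if g (fst y) (snd (snd y)) then fst y # fst (snd y) else fst (snd y))"
      by (intro ptime_if ptime_Cons) (simp, (rule ptime_rules)+)
    fix x a s assume x: "x \<in> D" and a: "a \<in> set (lst x)"
    then show "val_size (encL eB (if g a x then a # s else s)) \<le> val_size (encL eB s) + c (val_size (eA x))"
      using val_size_member[OF a, of eB] c(2)[OF x] by (simp add: encL_def)
  qed
  moreover have "foldl (\<lambda>s a. if g a x then a # s else s) t l = rev (filter (\<lambda>a. g a x) l) @ t" for x t l
    by (induction l arbitrary: t) auto
  ultimately have "ptime D eA (encL eB) (\<lambda>x. rev (filter (\<lambda>a. g a x) (lst x)))" by simp
  from ptime_rev[OF this] show ?thesis by simp
qed

lemma ptime_member:
  assumes e: "inj eB" and f: "ptime D eA eB f" and l: "ptime D eA (encL eB) l"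
  shows "ptime D eA encB (\<lambda>x. f x \<in> set (l x))"
proof -
  have *: "ptime UNIV (encP eB (encL eB)) encB (\<lambda>y. fst y \<in> set (snd y))"
  proof -
    have "ptime UNIV (encP eB (encL eB)) (encL eB) (\<lambda>y. filter (\<lambda>a. a = fst y) (snd y))"
      by (rule ptime_filter[where g = "\<lambda>a y. a = fst y"] ptime_eq[OF e] ptime_rules)+
    from ptime_not[OF ptime_null[OF this]] show ?thesis
      by (simp add: filter_empty_conv)
  qed
  from ptime_app[OF this ptime_Pair[OF f l]] show ?thesis by simp
qed

lemma ptime_length:
  assumes f: "ptime D eA (encL eB) f"
  shows "ptime D eA Num (\<lambda>x. length (f x))"
proof -
  have "ptime D eA Num (\<lambda>x. foldl (\<lambda>s a. s + 1) 0 (f x))"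
  proof (rule ptime_foldl_linear[OF _ ptime_nat f polyb_const[of 1]])
    show "ptime UNIV (encP eB (encP Num eA)) Num (\<lambda>y. fst (snd y) + 1)"
      by (rule ptime_plus ptime_nat ptime_rules)+
  qed (use floorlog_add_le[of _ 1] in \<open>simp add: floorlog_def\<close>)
  moreover have "foldl (\<lambda>s a. s + 1) n l = n + length l" for n and l :: "'b list"
    by (induction l arbitrary: n) auto
  ultimately show ?thesis by simp
qed

section \<open>A lower bound on the excess\<close>

definition chi :: "nat set \<Rightarrow> (nat \<Rightarrow> int) \<Rightarrow> int" where
  "chi A x = (\<Prod>i\<in>A. x i)"

text \<open>Assignments are total on the naturals, so that a system and its kernel are evaluated on
  one space although their variables differ.\<close>

definition cube :: "(nat \<Rightarrow> int) set" where
  "cube = {x. \<forall>i. x i \<in> {-1, 1}}"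

text \<open>The sum over GF(2) of the indicator vectors of the members of \<open>T\<close>, read as
  a set.\<close>

definition sd :: "nat set set \<Rightarrow> nat set" where
  "sd T = {i. odd (card {K \<in> T. i \<in> K})}"

definition symdiff :: "nat set \<Rightarrow> nat set \<Rightarrow> nat set" where
  "symdiff A B = (A - B) \<union> (B - A)"

lemma mem_symdiff: "i \<in> symdiff A B \<longleftrightarrow> (i \<in> A) \<noteq> (i \<in> B)"
  by (auto simp: symdiff_def)

lemma symdiff_simps [simp]:
  "symdiff A A = {}" "symdiff A {} = A" "symdiff {} A = A" "symdiff A (symdiff A B) = B"
  by (auto simp: symdiff_def)

lemma symdiff_assoc: "symdiff (symdiff A B) C = symdiff A (symdiff B C)"
  by (auto simp: symdiff_def)

lemma chi_sign: "x \<in> cube \<Longrightarrow> chi A x \<in> {-1, 1}"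
  unfolding chi_def cube_def
  by (induction A rule: infinite_finite_induct) auto

text \<open>Common variables enter the product twice and their squares are 1.\<close>

lemma chi_symdiff:
  assumes "finite A" "finite B" "x \<in> cube"
  shows "chi (symdiff A B) x = chi A x * chi B x"
proof -
  have sq: "(\<Prod>i\<in>A \<inter> B. x i) * (\<Prod>i\<in>A \<inter> B. x i) = 1"
    using chi_sign[OF assms(3), of "A \<inter> B"] unfolding chi_def by auto
  have "(\<Prod>i\<in>A. x i) = (\<Prod>i\<in>A - B. x i) * (\<Prod>i\<in>A \<inter> B. x i)"
    using prod.Int_Diff[OF assms(1), of x B] by (simp add: mult.commute)
  moreover have "(\<Prod>i\<in>B. x i) = (\<Prod>i\<in>B - A. x i) * (\<Prod>i\<in>A \<inter> B. x i)"
    using prod.Int_Diff[OF assms(2), of x A] by (simp add: mult.commute Int_commute)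
  moreover have "(\<Prod>i\<in>symdiff A B. x i) = (\<Prod>i\<in>A - B. x i) * (\<Prod>i\<in>B - A. x i)"
    unfolding symdiff_def using assms by (intro prod.union_disjoint) auto
  ultimately show ?thesis unfolding chi_def using sq by (simp add: algebra_simps)
qed

lemma sd_empty [simp]: "sd {} = {}"
  by (simp add: sd_def)

lemma sd_Un:
  assumes "finite U" "finite V" "U \<inter> V = {}"
  shows "sd (U \<union> V) = symdiff (sd U) (sd V)"
proof -
  have "card {K \<in> U \<union> V. i \<in> K} = card {K \<in> U. i \<in> K} + card {K \<in> V. i \<in> K}" for i
    using assms by (subst card_Un_disjoint[symmetric]) (auto intro: arg_cong[of _ _ card])
  then show ?thesis by (auto simp: sd_def mem_symdiff set_eq_iff)
qed

lemma sd_singleton [simp]: "sd {A} = A"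
proof -
  have "{K \<in> {A}. i \<in> K} = (if i \<in> A then {A} else {})" for i by auto
  then show ?thesis by (auto simp: sd_def)
qed

lemma sd_insert: "finite T \<Longrightarrow> A \<notin> T \<Longrightarrow> sd (insert A T) = symdiff A (sd T)"
  using sd_Un[of "{A}" T] by simp

lemma sd_subset: "sd T \<subseteq> \<Union>T"
proof
  fix i assume "i \<in> sd T"
  then have "{K \<in> T. i \<in> K} \<noteq> {}" unfolding sd_def by (metis card.empty even_zero mem_Collect_eq)
  then show "i \<in> \<Union>T" by blast
qed

lemma finite_sd: "finite T \<Longrightarrow> (\<And>A. A \<in> T \<Longrightarrow> finite A) \<Longrightarrow> finite (sd T)"
  by (rule finite_subset[OF sd_subset]) auto

lemma chi_sd:
  assumes "finite T" "\<And>A. A \<in> T \<Longrightarrow> finite A" "x \<in> cube"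
  shows "(\<Prod>A\<in>T. chi A x) = chi (sd T) x"
  using assms
proof (induction T)
  case empty
  then show ?case by (simp add: chi_def)
next
  case (insert A T)
  then show ?case by (simp add: sd_insert chi_symdiff finite_sd)
qed

section \<open>The span over GF(2)\<close>

definition xspan :: "nat set set \<Rightarrow> nat set set" where
  "xspan M = {sd T | T. finite T \<and> T \<subseteq> M}"

text \<open>Adding \<open>A\<close> to the sum means inserting it into \<open>T\<close>, or deleting
  it if it is already there. The bound on the cardinality is what the minimality argument
  consumes.\<close>

lemma sd_toggle:
  assumes "finite T" "T \<subseteq> M" "A \<in> M"
  obtains T' where "finite T'" "T' \<subseteq> M" "sd T' = symdiff A (sd T)" "card T' \<le> card T + 1"
proof (cases "A \<in> T")
  case True
  then have "sd T = symdiff A (sd (T - {A}))"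
    using sd_insert[of "T - {A}" A] assms by (simp add: insert_absorb)
  then show ?thesis using that[of "T - {A}"] assms by (auto intro: le_SucI card_Diff1_le)
next
  case False
  then show ?thesis using that[of "insert A T"] sd_insert[of T A] assms by auto
qed

lemma xspan_empty: "{} \<in> xspan M"
  unfolding xspan_def by (auto intro!: exI[of _ "{}"])

lemma xspan_member: "A \<in> M \<Longrightarrow> A \<in> xspan M"
  unfolding xspan_def by (auto intro!: exI[of _ "{A}"])

lemma xspan_toggle: "A \<in> M \<Longrightarrow> B \<in> xspan M \<Longrightarrow> symdiff A B \<in> xspan M"
proof -
  assume A: "A \<in> M" and "B \<in> xspan M"
  then obtain T where "finite T" "T \<subseteq> M" "B = sd T" unfolding xspan_def by blast
  then show ?thesis using sd_toggle[of T M A] A unfolding xspan_def by (smt (verit) mem_Collect_eq)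
qed

lemma xspan_symdiff:
  assumes "A \<in> xspan M" "B \<in> xspan M"
  shows "symdiff A B \<in> xspan M"
proof -
  obtain T where T: "finite T" "T \<subseteq> M" "A = sd T" using assms(1) unfolding xspan_def by blast
  have "symdiff (sd T) B \<in> xspan M" using T(1,2)
    by (induction T) (simp_all add: assms(2) sd_insert symdiff_assoc xspan_toggle)
  then show ?thesis using T(3) by simp
qed

section \<open>Averages over finitely many assignments\<close>

definition signs :: "nat set \<Rightarrow> (nat \<Rightarrow> int) set" where
  "signs V = {x. \<forall>i. x i \<in> (if i \<in> V then {-1, 1} else {1})}"

lemma signs_cube: "signs V \<subseteq> cube"
  unfolding signs_def cube_def by (auto split: if_splits)

lemma signs_finite:
  assumes "finite V"
  shows "finite (signs V)"
proof (rule finite_subset)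
  show "signs V \<subseteq> (\<lambda>S i. if i \<in> S then -1 else 1) ` Pow V"
  proof
    fix x assume "x \<in> signs V"
    then have "x = (\<lambda>i. if i \<in> {i \<in> V. x i = -1} then -1 else 1)"
      by (auto simp: signs_def fun_eq_iff split: if_splits)
    then show "x \<in> (\<lambda>S i. if i \<in> S then -1 else 1) ` Pow V" by blast
  qed
qed (use assms in simp)

lemma signs_nonempty: "signs V \<noteq> {}"
proof -
  have "(\<lambda>_. 1) \<in> signs V" by (simp add: signs_def)
  then show ?thesis by blast
qed

text \<open>Flipping one variable of \<open>A\<close> is an involution on \<open>signs V\<close>
  that negates \<open>chi A\<close>.\<close>

lemma chi_orthogonal:
  assumes "finite V" "A \<subseteq> V" "A \<noteq> {}"
  shows "(\<Sum>x\<in>signs V. chi A x) = 0"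
proof -
  obtain i where i: "i \<in> A" using assms by blast
  have fA: "finite A" using assms finite_subset by blast
  let ?f = "\<lambda>x :: nat \<Rightarrow> int. x(i := - x i)"
  have "bij_betw ?f (signs V) (signs V)"
    by (rule bij_betwI[where g = ?f]) (use i assms(2) in \<open>auto simp: signs_def split: if_splits\<close>)
  from sum.reindex_bij_betw[OF this, of "chi A"]
  have "(\<Sum>x\<in>signs V. chi A x) = (\<Sum>x\<in>signs V. chi A (?f x))" by simp
  also have "\<dots> = (\<Sum>x\<in>signs V. - chi A x)"
  proof (rule sum.cong)
    fix x :: "nat \<Rightarrow> int"
    have "(\<Prod>j\<in>A - {i}. (?f x) j) = (\<Prod>j\<in>A - {i}. x j)" by (rule prod.cong) auto
    then show "chi A (?f x) = - chi A x"
      unfolding chi_def using prod.remove[OF fA i, of x] prod.remove[OF fA i, of "?f x"] by simp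
  qed simp
  finally show ?thesis by (simp add: sum_negf)
qed

text \<open>\<open>T\<close> is a representation of least cardinality. A nonempty subfamily with sum
  \<open>{}\<close> could be dropped. Two or more members with sum in \<open>M\<close> could be
  traded, by \<open>sd_toggle\<close>, for at most one additional set. Either way a shorter
  representation of \<open>Y\<close> would result.\<close>

lemma minimal_representation:
  assumes Y: "Y \<in> xspan M"
  obtains T where "finite T" "T \<subseteq> M" "sd T = Y" "\<And>U. U \<subseteq> T \<Longrightarrow> sd U = {} \<Longrightarrow> U = {}"
    "\<And>U. U \<subseteq> T \<Longrightarrow> sd U \<in> M \<Longrightarrow> U = {sd U} \<or> U = {}"
proof -
  let ?R = "\<lambda>T. finite T \<and> T \<subseteq> M \<and> sd T = Y"
  have "\<exists>T. ?R T" using Y unfolding xspan_def by blast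
  then obtain T where T: "?R T" and min: "\<And>T'. ?R T' \<Longrightarrow> card T \<le> card T'"
    using ex_has_least_nat[of ?R _ card] by (metis (no_types, lifting))
  have split: "symdiff (sd U) (sd (T - U)) = Y" "card T = card U + card (T - U)" if "U \<subseteq> T" for U
  proof -
    have f: "finite U" "finite (T - U)" using T rev_finite_subset[OF _ that] by simp_all
    then show "symdiff (sd U) (sd (T - U)) = Y"
      using sd_Un[of U "T - U"] T that by (simp add: Un_absorb1)
    show "card T = card U + card (T - U)"
      using card_Un_disjoint[OF f] that by (simp add: Un_absorb1)
  qed
  show ?thesis
  proof (rule that[of T])
    fix U assume U: "U \<subseteq> T"
    have f: "finite U" using T rev_finite_subset[OF _ U] by simp
    show "U = {}" if "sd U = {}"
      using min[of "T - U"] split[OF U] that T f by auto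
    show "U = {sd U} \<or> U = {}" if "sd U \<in> M"
    proof (cases "card U \<ge> 2")
      case True
      have "finite (T - U)" "T - U \<subseteq> M" using T by auto
      then obtain T' where "finite T'" "T' \<subseteq> M" "sd T' = symdiff (sd U) (sd (T - U))"
        "card T' \<le> card (T - U) + 1"
        using sd_toggle \<open>sd U \<in> M\<close> by metis
      then have False using min[of T'] split[OF U] True by simp
      then show ?thesis ..
    next
      case False
      then have "card U = 0 \<or> card U = 1" by linarith
      then show ?thesis using f by (auto simp: card_1_singleton_iff)
    qed
  qed (use T in auto)
qed

lemma prod_one_plus:
  "finite T \<Longrightarrow> (\<Prod>K\<in>T. 1 + f K) = (\<Sum>U\<in>Pow T. \<Prod>K\<in>U. f K :: int)"
  using prod_add[of T f "\<lambda>_. 1"] by (simp add: add.commute)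

text \<open>Up to normalization \<open>w\<close> is a probability density: each factor is 0 or 2
  because \<open>c K\<close> is nonzero on \<open>T\<close>. Expanding it over the subfamilies of
  \<open>T\<close> turns the mean of the excess into a count of subfamilies with prescribed
  sum.\<close>

lemma excess_ge:
  fixes c :: "nat set \<Rightarrow> int"
  assumes V: "finite V" and F: "finite F" "F \<subseteq> Pow V" and M: "M = {A \<in> F. c A \<noteq> 0}" "{} \<notin> M"
    and r: "\<And>A. A \<in> M \<Longrightarrow> card A \<le> r" and Y: "Y \<in> xspan M" "r * (q - 1) < card Y"
  shows "\<exists>x\<in>signs V. int q \<le> (\<Sum>A\<in>F. c A * chi A x)"
proof -
  obtain T where T: "finite T" "T \<subseteq> M" "sd T = Y"
    and indep: "\<And>U. U \<subseteq> T \<Longrightarrow> sd U = {} \<Longrightarrow> U = {}"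
    and sum_free: "\<And>U. U \<subseteq> T \<Longrightarrow> sd U \<in> M \<Longrightarrow> U = {sd U} \<or> U = {}"
    by (rule minimal_representation[OF Y(1)], rule that)
  have sub: "A \<subseteq> V" "finite A" if "A \<in> M" for A
  proof -
    show "A \<subseteq> V" using that M F by blast
    then show "finite A" using V by (rule finite_subset)
  qed
  \<comment> \<open>Every element of \<open>Y\<close> lies in some member of \<open>T\<close>, and a
    member has at most \<open>r\<close> elements.\<close>
  have "card Y \<le> card (\<Union>T)"
    unfolding T(3)[symmetric] using T(1,2) sub by (intro card_mono sd_subset finite_Union) blast+
  also have "\<dots> \<le> (\<Sum>A\<in>T. card A)" using T sub by (intro card_Union_le_sum_card)
  also have "\<dots> \<le> (\<Sum>A\<in>T. r)" using T r by (intro sum_mono) auto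
  also have "\<dots> = r * card T" by simp
  finally have "r * (q - 1) < r * card T" using Y(2) by (rule less_le_trans[rotated])
  then have q: "q \<le> card T" by auto
  define E where "E x = (\<Sum>A\<in>F. c A * chi A x)" for x
  define w where "w x = (\<Prod>K\<in>T. 1 + sgn (c K) * chi K x)" for x
  define N where "N = int (card (signs V))"
  have N: "N > 0" unfolding N_def using signs_finite[OF V] signs_nonempty by (simp add: card_gt_0_iff)
  have w_nonneg: "w x \<ge> 0" if "x \<in> signs V" for x
    unfolding w_def
  proof (rule prod_nonneg)
    fix K
    have "chi K x \<in> {-1, 1}" using chi_sign that signs_cube by blast
    then show "0 \<le> 1 + sgn (c K) * chi K x" by (auto simp: sgn_if)
  qed
  have w_eq: "w x = (\<Sum>U\<in>Pow T. (\<Prod>K\<in>U. sgn (c K)) * chi (sd U) x)" if "x \<in> signs V" for x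
    unfolding w_def prod_one_plus[OF T(1)]
  proof (rule sum.cong)
    fix U assume "U \<in> Pow T"
    then have "finite U" "\<And>A. A \<in> U \<Longrightarrow> finite A" using T sub rev_finite_subset[OF T(1)] by auto
    from chi_sd[OF this] show "(\<Prod>K\<in>U. sgn (c K) * chi K x) = (\<Prod>K\<in>U. sgn (c K)) * chi (sd U) x"
      using that signs_cube by (simp add: prod.distrib subset_iff)
  qed simp
  \<comment> \<open>Orthogonality: the product of \<open>chi (sd U)\<close> and \<open>chi A\<close>
    is the character of their symmetric difference, which sums to zero unless
    \<open>sd U = A\<close>.\<close>
  have avg: "(\<Sum>x\<in>signs V. w x * chi A x) = (\<Sum>U\<in>{U \<in> Pow T. sd U = A}. \<Prod>K\<in>U. sgn (c K)) * N"
    if A: "A \<subseteq> V" for A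
  proof -
    have "(\<Sum>x\<in>signs V. w x * chi A x)
        = (\<Sum>x\<in>signs V. \<Sum>U\<in>Pow T. (\<Prod>K\<in>U. sgn (c K)) * (chi (sd U) x * chi A x))"
      by (rule sum.cong) (simp_all add: w_eq sum_distrib_right mult.assoc)
    also have "\<dots> = (\<Sum>U\<in>Pow T. \<Sum>x\<in>signs V. (\<Prod>K\<in>U. sgn (c K)) * (chi (sd U) x * chi A x))"
      by (rule sum.swap)
    also have "\<dots> = (\<Sum>U\<in>Pow T. if sd U = A then (\<Prod>K\<in>U. sgn (c K)) * N else 0)"
    proof (rule sum.cong)
      fix U assume "U \<in> Pow T"
      then have U: "sd U \<subseteq> V" using sd_subset[of U] T(2) sub(1) by blast
      have fin: "finite (sd U)" "finite A" using U A V by (auto intro: rev_finite_subset)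
      have "(\<Sum>x\<in>signs V. chi (sd U) x * chi A x) = (\<Sum>x\<in>signs V. chi (symdiff (sd U) A) x)"
        by (intro sum.cong) (simp_all add: chi_symdiff[OF fin] subsetD[OF signs_cube])
      also have "\<dots> = (if sd U = A then N else 0)"
      proof (cases "sd U = A")
        case False
        then have "symdiff (sd U) A \<noteq> {}" by (auto simp: symdiff_def)
        then show ?thesis using False chi_orthogonal[OF V] U A by (simp add: symdiff_def subset_iff)
      qed (simp add: chi_def N_def)
      finally show "(\<Sum>x\<in>signs V. (\<Prod>K\<in>U. sgn (c K)) * (chi (sd U) x * chi A x))
          = (if sd U = A then (\<Prod>K\<in>U. sgn (c K)) * N else 0)"
        by (simp flip: sum_distrib_left)
    qed simp
    also have "\<dots> = (\<Sum>U\<in>{U \<in> Pow T. sd U = A}. (\<Prod>K\<in>U. sgn (c K)) * N)"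
      using T(1) by (subst sum.inter_filter) auto
    finally show ?thesis by (simp add: sum_distrib_right)
  qed
  \<comment> \<open>Independence leaves only the empty subfamily for the constant character, so the
    weights have mean 1.\<close>
  have "{U \<in> Pow T. sd U = {}} = {{}}" using indep by auto
  then have w_sum: "(\<Sum>x\<in>signs V. w x) = N"
    using avg[of "{}"] by (simp add: chi_def)
  \<comment> \<open>For a nonzero coefficient only \<open>U = {A}\<close> can have sum
    \<open>A\<close>, and only if \<open>A\<close> is in \<open>T\<close>; then the sign in the
    weight turns \<open>c A\<close> into its absolute value.\<close>
  have coeff: "c A * (\<Sum>x\<in>signs V. w x * chi A x) = (if A \<in> T then \<bar>c A\<bar> * N else 0)"
    if A: "A \<in> F" for A
  proof (cases "c A = 0")
    case True
    then show ?thesis by simp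
  next
    case False
    then have "A \<in> M" using M A by simp
    have "A \<noteq> {}" using \<open>A \<in> M\<close> M(2) by blast
    have "U \<in> Pow T \<and> sd U = A \<longleftrightarrow> A \<in> T \<and> U = {A}" for U
    proof
      assume U: "U \<in> Pow T \<and> sd U = A"
      then have "U = {A} \<or> U = {}" using sum_free[of U] \<open>A \<in> M\<close> by blast
      then show "A \<in> T \<and> U = {A}" using U \<open>A \<noteq> {}\<close> by auto
    qed auto
    then have "{U \<in> Pow T. sd U = A} = (if A \<in> T then {{A}} else {})" by auto
    then show ?thesis using avg[of A] sub(1)[OF \<open>A \<in> M\<close>]
      by (simp add: abs_sgn mult.assoc mult.commute mult.left_commute)
  qed
  have "(\<Sum>x\<in>signs V. w x * E x) = (\<Sum>A\<in>F. c A * (\<Sum>x\<in>signs V. w x * chi A x))"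
    unfolding E_def sum_distrib_left by (subst sum.swap) (simp add: mult.left_commute)
  also have "\<dots> = (\<Sum>A\<in>F. if A \<in> T then \<bar>c A\<bar> * N else 0)"
    by (rule sum.cong) (simp_all add: coeff)
  also have "\<dots> = (\<Sum>A\<in>T. \<bar>c A\<bar> * N)"
  proof -
    have "{A \<in> F. A \<in> T} = T" using T(2) M(1) by auto
    then show ?thesis using sum.inter_filter[OF F(1), of "\<lambda>A. \<bar>c A\<bar> * N" "\<lambda>A. A \<in> T"] by simp
  qed
  \<comment> \<open>Nonzero integer coefficients have absolute value at least 1.\<close>
  also have "\<dots> \<ge> (\<Sum>A\<in>T. N)"
    using T M N by (intro sum_mono) auto
  finally have ge: "int (card T) * N \<le> (\<Sum>x\<in>signs V. w x * E x)" by simp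
  show ?thesis
  proof (rule ccontr)
    assume "\<not> ?thesis"
    \<comment> \<open>The excess is an integer, so missing \<open>q\<close> means at most
      \<open>q - 1\<close>; with nonnegative weights of total \<open>N\<close> the average could
      then not reach \<open>card T\<close>.\<close>
    then have "E x \<le> int q - 1" if "x \<in> signs V" for x using that unfolding E_def by force
    then have "(\<Sum>x\<in>signs V. w x * E x) \<le> (\<Sum>x\<in>signs V. w x * (int q - 1))"
      by (intro sum_mono mult_left_mono w_nonneg)
    also have "\<dots> = N * (int q - 1)" using w_sum by (simp flip: sum_distrib_right)
    also have "\<dots> < N * int (card T)" using N q by simp
    finally show False using ge by (simp add: mult.commute)
  qed
qed

section \<open>Gaussian elimination\<close>

text \<open>Rows are sublists of the fixed list \<open>V\<close>, which keeps their size bounded during the elimination.\<close>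

definition xorl :: "nat list \<Rightarrow> nat list \<Rightarrow> nat list \<Rightarrow> nat list" where
  "xorl V l s = filter (\<lambda>v. (v \<in> set l) \<noteq> (v \<in> set s)) V"

definition reduce :: "nat list \<Rightarrow> nat list list \<Rightarrow> nat list \<Rightarrow> nat list" where
  "reduce V B l = foldl (\<lambda>l s. if hd s \<in> set l then xorl V l s else l) l B"

definition eliminate :: "nat list \<Rightarrow> nat list list \<Rightarrow> nat list list" where
  "eliminate V ls = foldl (\<lambda>B l. if reduce V B l = [] then B else B @ [reduce V B l]) [] ls"

lemma set_xorl: "set l \<subseteq> set V \<Longrightarrow> set s \<subseteq> set V \<Longrightarrow> set (xorl V l s) = symdiff (set l) (set s)"
  by (auto simp: xorl_def symdiff_def)

text \<open>The pivot of a row is its first entry.\<close>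

definition echelon :: "nat list list \<Rightarrow> bool" where
  "echelon B \<longleftrightarrow> (\<forall>s\<in>set B. s \<noteq> []) \<and> sorted_wrt (\<lambda>s s'. hd s \<notin> set s') B"

lemma echelon_Nil [simp]: "echelon []"
  by (simp add: echelon_def)

lemma echelon_Cons: "echelon (s # B) \<longleftrightarrow> s \<noteq> [] \<and> (\<forall>s'\<in>set B. hd s \<notin> set s') \<and> echelon B"
  by (auto simp: echelon_def)

lemma echelon_snoc:
  "echelon (B @ [s]) \<longleftrightarrow> echelon B \<and> s \<noteq> [] \<and> (\<forall>s'\<in>set B. hd s' \<notin> set s)"
  by (auto simp: echelon_def sorted_wrt_append)

lemma reduce_Cons: "reduce V (s # B) l = reduce V B (if hd s \<in> set l then xorl V l s else l)"
  by (simp add: reduce_def)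

lemma reduce_subset:
  "set l \<subseteq> set V \<Longrightarrow> set (reduce V B l) \<subseteq> set V"
proof (induction B arbitrary: l)
  case (Cons s B)
  have "set (if hd s \<in> set l then xorl V l s else l) \<subseteq> set V" using Cons.prems by (auto simp: xorl_def)
  then show ?case unfolding reduce_Cons by (rule Cons.IH)
qed (simp add: reduce_def)

lemma reduce_pivot_free:
  assumes "p \<notin> set l" "\<And>s. s \<in> set B \<Longrightarrow> p \<notin> set s" "set l \<subseteq> set V" "\<And>s. s \<in> set B \<Longrightarrow> set s \<subseteq> set V"
  shows "p \<notin> set (reduce V B l)"
  using assms
proof (induction B arbitrary: l)
  case (Cons s B)
  have "p \<notin> set (if hd s \<in> set l then xorl V l s else l)" using Cons.prems by (auto simp: xorl_def)
  moreover have "set (if hd s \<in> set l then xorl V l s else l) \<subseteq> set V"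
    using Cons.prems by (auto simp: xorl_def)
  ultimately show ?case unfolding reduce_Cons by (intro Cons.IH) (simp_all add: Cons.prems)
qed (simp add: reduce_def)

text \<open>Once a row has cleared its pivot, only later rows are added, and in echelon form these
  do not contain it.\<close>

lemma reduce_pivots:
  assumes "echelon B" "set l \<subseteq> set V" "\<And>s. s \<in> set B \<Longrightarrow> set s \<subseteq> set V" "s \<in> set B"
  shows "hd s \<notin> set (reduce V B l)"
  using assms
proof (induction B arbitrary: l)
  case (Cons r B)
  let ?l = "if hd r \<in> set l then xorl V l r else l"
  have l: "set ?l \<subseteq> set V" using Cons.prems by (auto simp: xorl_def)
  show ?case
  proof (cases "s \<in> set B")
    case True
    have "echelon B" using Cons.prems(1) by (simp add: echelon_Cons)
    then show ?thesis unfolding reduce_Cons by (rule Cons.IH) (simp_all add: Cons.prems l True)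
  next
    case False
    then have s: "s = r" using Cons.prems by simp
    have "hd r \<in> set r" using Cons.prems by (simp add: echelon_Cons)
    then have "hd r \<notin> set ?l" by (auto simp: xorl_def)
    then show ?thesis unfolding reduce_Cons s
      using Cons.prems l by (intro reduce_pivot_free) (auto simp: echelon_Cons)
  qed
qed simp

lemma reduce_xspan:
  assumes "set l \<in> xspan M" "\<And>s. s \<in> set B \<Longrightarrow> set s \<in> xspan M" "set l \<subseteq> set V"
    "\<And>s. s \<in> set B \<Longrightarrow> set s \<subseteq> set V"
  shows "set (reduce V B l) \<in> xspan M"
  using assms
proof (induction B arbitrary: l)
  case (Cons s B)
  have "set (if hd s \<in> set l then xorl V l s else l) \<in> xspan M"
    using Cons.prems set_xorl[of l V s] xspan_symdiff by auto
  moreover have "set (if hd s \<in> set l then xorl V l s else l) \<subseteq> set V"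
    using Cons.prems by (auto simp: xorl_def)
  ultimately show ?case unfolding reduce_Cons by (intro Cons.IH) (simp_all add: Cons.prems)
qed (simp add: reduce_def)

text \<open>Adding a row multiplies the values at \<open>x\<close> and at \<open>y\<close> by the
  same sign, so equality is preserved in both directions.\<close>

lemma chi_reduce_eq:
  assumes "x \<in> cube" "y \<in> cube" "\<And>s. s \<in> set B \<Longrightarrow> chi (set s) x = chi (set s) y"
    "set l \<subseteq> set V" "\<And>s. s \<in> set B \<Longrightarrow> set s \<subseteq> set V"
  shows "chi (set (reduce V B l)) x = chi (set (reduce V B l)) y \<longleftrightarrow> chi (set l) x = chi (set l) y"
  using assms
proof (induction B arbitrary: l)
  case (Cons s B)
  let ?l = "if hd s \<in> set l then xorl V l s else l"
  have "set ?l \<subseteq> set V" using Cons.prems by (auto simp: xorl_def)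
  then have "chi (set (reduce V (s # B) l)) x = chi (set (reduce V (s # B) l)) y \<longleftrightarrow>
      chi (set ?l) x = chi (set ?l) y"
    unfolding reduce_Cons by (intro Cons.IH) (simp_all add: Cons.prems)
  also have "\<dots> \<longleftrightarrow> chi (set l) x = chi (set l) y"
  proof (cases "hd s \<in> set l")
    case True
    then have "set ?l = symdiff (set l) (set s)" using set_xorl[of l V s] Cons.prems by auto
    moreover have "chi (set s) x = chi (set s) y" "chi (set s) y \<in> {-1, 1}"
      using Cons.prems chi_sign by auto
    ultimately show ?thesis using Cons.prems by (auto simp: chi_symdiff)
  qed simp
  finally show ?case .
qed (simp add: reduce_def)

text \<open>The third clause puts the rows into the span of the equations. The fourth replaces the
  converse inclusion: the values of the rows determine those of the equations.\<close>

lemma eliminate_invariant: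
  assumes "\<forall>l\<in>set ls. set l \<subseteq> set V"
  shows "echelon (eliminate V ls) \<and> (\<forall>s\<in>set (eliminate V ls). set s \<subseteq> set V) \<and>
    (\<forall>M. set ` set ls \<subseteq> M \<longrightarrow> (\<forall>s\<in>set (eliminate V ls). set s \<in> xspan M)) \<and>
    (\<forall>x\<in>cube. \<forall>y\<in>cube. (\<forall>s\<in>set (eliminate V ls). chi (set s) x = chi (set s) y) \<longrightarrow>
      (\<forall>l\<in>set ls. chi (set l) x = chi (set l) y))"
  using assms
proof (induction ls rule: rev_induct)
  case Nil
  then show ?case by (simp add: eliminate_def)
next
  case (snoc l ls)
  define B where "B = eliminate V ls"
  define r where "r = reduce V B l"
  define B' where "B' = eliminate V (ls @ [l])"
  have B': "B' = (if r = [] then B else B @ [r])" by (simp add: B'_def eliminate_def B_def r_def)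
  have l: "set l \<subseteq> set V" using snoc.prems by simp
  have IH: "echelon B" "\<And>s. s \<in> set B \<Longrightarrow> set s \<subseteq> set V"
    "\<And>M s. set ` set ls \<subseteq> M \<Longrightarrow> s \<in> set B \<Longrightarrow> set s \<in> xspan M"
    "\<And>x y. x \<in> cube \<Longrightarrow> y \<in> cube \<Longrightarrow> \<forall>s\<in>set B. chi (set s) x = chi (set s) y \<Longrightarrow>
      \<forall>l\<in>set ls. chi (set l) x = chi (set l) y"
  proof -
    have "\<forall>l\<in>set ls. set l \<subseteq> set V" using snoc.prems by simp
    note IH = snoc.IH[OF this, folded B_def]
    show "echelon B" using IH by blast
    show "set s \<subseteq> set V" if "s \<in> set B" for s using IH that by blast
    show "set s \<in> xspan M" if "set ` set ls \<subseteq> M" "s \<in> set B" for M s using IH that by blast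
    show "\<forall>l\<in>set ls. chi (set l) x = chi (set l) y"
      if "x \<in> cube" "y \<in> cube" "\<forall>s\<in>set B. chi (set s) x = chi (set s) y" for x y
      using IH that by blast
  qed
  have I1: "echelon B'" unfolding B' using IH(1) reduce_pivots[OF IH(1) l IH(2)] by (simp add: echelon_snoc r_def)
  have I2: "set s \<subseteq> set V" if "s \<in> set B'" for s
    using that unfolding B' using IH(2) reduce_subset[OF l, of B] by (auto simp: r_def split: if_splits)
  have I3: "set s \<in> xspan M" if M: "set ` set (ls @ [l]) \<subseteq> M" and s: "s \<in> set B'" for M s
  proof -
    have "set r \<in> xspan M" unfolding r_def
      using M by (intro reduce_xspan[OF xspan_member _ l IH(2)] IH(3)) auto
    then show ?thesis using s IH(3)[of M s] M unfolding B' by (auto split: if_splits)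
  qed
  have I4: "chi (set k) x = chi (set k) y"
    if x: "x \<in> cube" and y: "y \<in> cube" and xy: "\<forall>s\<in>set B'. chi (set s) x = chi (set s) y"
      and k: "k \<in> set (ls @ [l])" for x y k
  proof -
    have B: "\<forall>s\<in>set B. chi (set s) x = chi (set s) y" using xy unfolding B' by (auto split: if_splits)
    \<comment> \<open>An empty remainder has the empty product as its value at both assignments; a
      nonempty one is itself a row.\<close>
    have "chi (set r) x = chi (set r) y"
      using xy unfolding B' by (cases "r = []") (simp_all add: chi_def)
    then have "chi (set l) x = chi (set l) y"
      using chi_reduce_eq[OF x y _ l IH(2), of B] B unfolding r_def by auto
    then show ?thesis using IH(4)[OF x y B] k by auto
  qed
  show ?case unfolding B'_def[symmetric]
  proof (intro conjI allI impI ballI)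
    show "echelon B'" by (rule I1)
    show "set s \<subseteq> set V" if "s \<in> set B'" for s using that by (rule I2)
    show "set s \<in> xspan M" if "set ` set (ls @ [l]) \<subseteq> M" "s \<in> set B'" for M s
      using that by (rule I3)
    show "chi (set k) x = chi (set k) y"
      if "x \<in> cube" "y \<in> cube" "\<forall>s\<in>set B'. chi (set s) x = chi (set s) y" "k \<in> set (ls @ [l])" for x y k
      using that by (rule I4)
  qed
qed

section \<open>Consequences of the echelon form\<close>

lemma echelon_hd_in: "echelon B \<Longrightarrow> s \<in> set B \<Longrightarrow> hd s \<in> set s"
  by (simp add: echelon_def)

lemma echelon_distinct: "echelon B \<Longrightarrow> distinct (map hd B)"
proof (induction B)
  case (Cons s B)
  then have "hd s \<noteq> hd r" if "r \<in> set B" for r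
    using echelon_hd_in[of B r] that by (auto simp: echelon_Cons)
  then show ?case using Cons by (auto simp: echelon_Cons)
qed simp

text \<open>Back substitution: the tail is adjusted first, and if the head row still has the wrong
  sign its pivot is flipped, which changes no row of the tail since the pivot does not occur
  there.\<close>

lemma echelon_adjust:
  assumes "echelon B" "x \<in> cube" "y \<in> cube"
  shows "\<exists>z\<in>cube. (\<forall>i. i \<notin> set (map hd B) \<longrightarrow> z i = y i) \<and> (\<forall>s\<in>set B. chi (set s) z = chi (set s) x)"
  using assms
proof (induction B)
  case Nil
  then show ?case by auto
next
  case (Cons s B)
  then obtain z where z: "z \<in> cube" "\<And>i. i \<notin> set (map hd B) \<Longrightarrow> z i = y i"
    "\<And>r. r \<in> set B \<Longrightarrow> chi (set r) z = chi (set r) x"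
    by (auto simp: echelon_Cons)
  let ?p = "hd s"
  define w where "w = z(?p := - z ?p)"
  have w: "w ?p = - z ?p" "\<And>i. i \<noteq> ?p \<Longrightarrow> w i = z i" by (simp_all add: w_def)
  have p: "?p \<in> set s" "\<And>r. r \<in> set B \<Longrightarrow> ?p \<notin> set r" using Cons.prems by (auto simp: echelon_Cons)
  show ?case
  proof (cases "chi (set s) z = chi (set s) x")
    case True
    then show ?thesis using z by (intro bexI[of _ z]) auto
  next
    case False
    have "chi (set s) z \<in> {-1, 1}" "chi (set s) x \<in> {-1, 1}" using chi_sign z(1) Cons.prems by auto
    then have neg: "chi (set s) x = - chi (set s) z" using False by auto
    have "(\<Prod>j\<in>set s - {?p}. w j) = (\<Prod>j\<in>set s - {?p}. z j)" by (rule prod.cong) (auto simp: w)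
    then have "chi (set s) w = chi (set s) x"
      unfolding neg unfolding chi_def
      using prod.remove[OF finite_set p(1), of z] prod.remove[OF finite_set p(1), of w] by (simp add: w)
    moreover have "chi (set r) w = chi (set r) x" if "r \<in> set B" for r
    proof -
      have "chi (set r) w = chi (set r) z"
        unfolding chi_def using p(2)[OF that] by (intro prod.cong) (auto intro!: w)
      then show ?thesis using z(3)[OF that] by simp
    qed
    moreover have "w \<in> cube"
    proof -
      have "z i = -1 \<or> z i = 1" for i using z(1) by (simp add: cube_def)
      then have "w i = -1 \<or> w i = 1" for i
        using w by (cases "i = ?p") (metis add.inverse_inverse, simp)
      then show ?thesis by (simp add: cube_def)
    qed
    ultimately show ?thesis using z(2) w(2) by (intro bexI[of _ w]) auto
  qed
qed

text \<open>Rows are taken from the front. If \<open>Y\<close> lacks the pivot of the next row, that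
  row is added; it contains no earlier pivot, so those already collected stay in.\<close>

lemma echelon_span_pivots:
  assumes "echelon B" "\<And>s. s \<in> set B \<Longrightarrow> set s \<in> xspan M"
  shows "\<exists>Y\<in>xspan M. set (map hd B) \<subseteq> Y"
  using assms
proof (induction B rule: rev_induct)
  case Nil
  then show ?case using xspan_empty by auto
next
  case (snoc s B)
  then obtain Y where Y: "Y \<in> xspan M" "set (map hd B) \<subseteq> Y" by (auto simp: echelon_snoc)
  show ?case
  proof (cases "hd s \<in> Y")
    case True
    then show ?thesis using Y by (intro bexI[of _ Y]) auto
  next
    case False
    have "hd s \<in> set s" "\<forall>r\<in>set B. hd r \<notin> set s" using snoc.prems by (auto simp: echelon_snoc)
    then have "set (map hd (B @ [s])) \<subseteq> symdiff (set s) Y" using Y(2) False by (auto simp: mem_symdiff)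
    moreover have "symdiff (set s) Y \<in> xspan M" using snoc.prems(2)[of s] Y(1) by (intro xspan_symdiff) auto
    ultimately show ?thesis by blast
  qed
qed

section \<open>The kernelization algorithm\<close>

text \<open>Nested pairs ending in a unit mirror \<open>enc_list\<close>, whose terminator
  \<open>Num 0\<close> becomes the code of the unit. Thus \<open>encI\<close> produces the same
  values as \<open>enc_inst\<close>, while the pair combinators apply.\<close>

type_synonym teq = "nat list \<times> nat \<times> nat \<times> unit"
type_synonym tinst = "nat \<times> teq list \<times> nat \<times> nat \<times> unit"

definition encU :: "unit \<Rightarrow> val" where "encU u = Num 0"

abbreviation encE :: "teq \<Rightarrow> val" where
  "encE \<equiv> encP (encL Num) (encP Num (encP Num encU))"

abbreviation encI :: "tinst \<Rightarrow> val" where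
  "encI \<equiv> encP Num (encP (encL encE) (encP Num (encP Num encU)))"

text \<open>The language has natural numbers only, so a signed coefficient is kept as two sums:
  \<open>b = 1\<close> for right-hand side 1 and \<open>b = 0\<close> for -1.\<close>

definition wsum :: "nat \<Rightarrow> nat list \<Rightarrow> teq list \<Rightarrow> nat" where
  "wsum b l es = foldl (\<lambda>s e. if fst e = l \<and> fst (snd e) = b then s + fst (snd (snd e)) else s) 0 es"

text \<open>Equations whose left-hand side has cancelling total weight contribute nothing to the excess.
  They must be dropped, as the lower bound on the excess needs nonzero coefficients.\<close>

definition unbalanced :: "teq list \<Rightarrow> teq list" where
  "unbalanced es = filter (\<lambda>e. wsum 1 (fst e) es \<noteq> wsum 0 (fst e) es) es"

text \<open>Repeated entries are harmless: elimination inspects a row only through its set, its head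
  and its emptiness.\<close>

definition vars_of :: "teq list \<Rightarrow> nat list" where
  "vars_of es = foldl (\<lambda>s e. s @ fst e) [] es"

definition index :: "nat list \<Rightarrow> (nat \<times> nat) list" where
  "index P = foldl (\<lambda>I p. I @ [(p, length I + 1)]) [] P"

text \<open>Filtering the index instead of the equation yields the new numbers in increasing order,
  so no sorting has to be programmed.\<close>

definition restrict_eq :: "(nat \<times> nat) list \<Rightarrow> teq \<Rightarrow> teq" where
  "restrict_eq I e = (map snd (filter (\<lambda>a. fst a \<in> set (fst e)) I), snd e)"

definition rows :: "teq list \<Rightarrow> nat list list" where
  "rows es = eliminate (vars_of es) (map fst es)"

definition shrink :: "teq list \<Rightarrow> teq list" where
  "shrink es = map (restrict_eq (index (map hd (rows es)))) es"

text \<open>The fallback is a smallest yes-instance, with no equation and \<open>k = 0\<close>. For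
  an input with \<open>k = 0\<close> the truncated \<open>2 * k - 1\<close> is 0, and the answer is
  yes in any case.\<close>

definition kernel :: "tinst \<Rightarrow> tinst" where
  "kernel y = (if length (rows (unbalanced (fst (snd y))))
      \<le> (2 * fst (snd (snd y)) - 1) * fst (snd (snd (snd y)))
    then (length (rows (unbalanced (fst (snd y)))), shrink (unbalanced (fst (snd y))), snd (snd y))
    else (0, [], 0, snd (snd (snd y))))"

section \<open>Running time of the kernelization\<close>

lemma ptime_le:
  assumes "ptime D eA Num f" "ptime D eA Num g"
  shows "ptime D eA encB (\<lambda>x. f x \<le> g x)"
  using ptime_not[OF ptime_less[OF assms(2,1)]] by (simp add: not_less)

lemma val_size_Num_add: "val_size (Num (m + n)) \<le> val_size (Num m) + floorlog 2 n"
  using floorlog_add_le[of m n] by simp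

lemma ptime_wsum: "ptime UNIV (encP encE (encL encE)) Num (\<lambda>y. wsum b (fst (fst y)) (snd y))"
  unfolding wsum_def
proof (rule ptime_foldl_linear[where q = "\<lambda>n. n" and
      f = "\<lambda>a s y. if fst a = fst (fst y) \<and> fst (snd a) = b then s + fst (snd (snd a)) else s"])
  show "ptime UNIV (encP encE (encP Num (encP encE (encL encE)))) Num
     (\<lambda>y. if fst (fst y) = fst (fst (snd (snd y))) \<and> fst (snd (fst y)) = b
           then fst (snd y) + fst (snd (snd (fst y))) else fst (snd y))"
    by (rule ptime_if ptime_conj ptime_eq[OF inj_encL[OF inj_Num]] ptime_eq[OF inj_Num] ptime_nat
        ptime_plus ptime_rules)+
  fix x :: "teq \<times> teq list" and a :: teq and s
  assume "a \<in> set (snd x)"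
  then have "val_size (encE a) \<le> val_size (encP encE (encL encE) x)"
    using val_size_member[of a "snd x" encE] by (simp add: encP_def)
  moreover have "floorlog 2 (fst (snd (snd a))) \<le> val_size (encE a)" by (simp add: encP_def)
  ultimately show "val_size (Num (if fst a = fst (fst x) \<and> fst (snd a) = b then s + fst (snd (snd a)) else s))
       \<le> val_size (Num s) + val_size (encP encE (encL encE) x)"
    using val_size_Num_add[of s "fst (snd (snd a))"] by auto
qed (rule polyb_id ptime_nat ptime_rules)+

lemma ptime_unbalanced: "ptime UNIV (encL encE) (encL encE) unbalanced"
proof -
  have "ptime UNIV (encL encE) (encL encE)
      (\<lambda>es. filter (\<lambda>e. wsum 1 (fst e) es \<noteq> wsum 0 (fst e) es) es)"
    by (rule ptime_filter[where g = "\<lambda>e es. wsum 1 (fst e) es \<noteq> wsum 0 (fst e) es"]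
        ptime_not ptime_eq[OF inj_Num] ptime_wsum ptime_id)+
  then show ?thesis unfolding unbalanced_def[abs_def] .
qed

lemma foldl_append: "foldl (\<lambda>s e. s @ h e) t es = t @ concat (map h es)"
  by (induction es arbitrary: t) auto

lemma set_vars_of: "set (vars_of es) = (\<Union>e\<in>set es. set (fst e))"
  unfolding vars_of_def foldl_append by simp

lemma val_size_append: "val_size (encL e (l @ m)) + 1 = val_size (encL e l) + val_size (encL e m)"
  by (simp add: val_size_encL)

lemma ptime_vars_of: "ptime UNIV (encL encE) (encL Num) vars_of"
proof -
  have "ptime UNIV (encL encE) (encL Num) (\<lambda>es. foldl (\<lambda>s e. s @ fst e) [] es)"
  proof (rule ptime_foldl_linear[where q = "\<lambda>n. n" and f = "\<lambda>e s es. s @ fst e"])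
    show "ptime UNIV (encP encE (encP (encL Num) (encL encE))) (encL Num) (\<lambda>y. fst (snd y) @ fst (fst y))"
      by (rule ptime_append ptime_rules)+
    fix es :: "teq list" and a s assume a: "a \<in> set es"
    have "val_size (encL Num (fst a)) \<le> val_size (encE a)" by (simp add: encP_def)
    then show "val_size (encL Num (s @ fst a)) \<le> val_size (encL Num s) + val_size (encL encE es)"
      using val_size_member[OF a, of encE] val_size_append[of Num s "fst a"] by linarith
  qed (rule polyb_id ptime_Nil ptime_rules)+
  then show ?thesis unfolding vars_of_def[abs_def] .
qed

lemma val_size_filter: "val_size (encL e (filter Q l)) \<le> val_size (encL e l)"
  by (induction l) (auto simp: encL_def)

text \<open>Either no row was added, or the last addition produced a sublist of \<open>V\<close>.
  The bound does not mention \<open>B\<close>.\<close>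

lemma val_size_reduce:
  "val_size (encL Num (reduce V B l)) \<le> max (val_size (encL Num l)) (val_size (encL Num V))"
proof (induction B arbitrary: l)
  case (Cons s B)
  have "val_size (encL Num (xorl V l s)) \<le> val_size (encL Num V)"
    unfolding xorl_def by (rule val_size_filter)
  then show ?case unfolding reduce_Cons
    using Cons[of "xorl V l s"] Cons[of l] by auto
qed (simp add: reduce_def)

lemma inj_encB: "inj encB"
  by (rule injI) (auto simp: encB_def of_bool_def split: if_splits)

lemma ptime_xorl:
  "ptime UNIV (encP (encL Num) (encP (encL Num) (encL Num))) (encL Num)
    (\<lambda>y. xorl (fst y) (fst (snd y)) (snd (snd y)))"
  unfolding xorl_def
  by (rule ptime_filter[where g = "\<lambda>v y. (v \<in> set (fst (snd y))) \<noteq> (v \<in> set (snd (snd y)))"]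
      ptime_not ptime_eq[OF inj_encB] ptime_member[OF inj_Num] ptime_rules)+

lemma ptime_reduce:
  "ptime UNIV (encP (encL Num) (encP (encL (encL Num)) (encL Num))) (encL Num)
    (\<lambda>y. reduce (fst y) (fst (snd y)) (snd (snd y)))"
  unfolding reduce_def
proof (rule ptime_foldl[where q = "\<lambda>n. n" and
      f = "\<lambda>s l y. if hd s \<in> set l then xorl (fst y) l s else l"])
  let ?e = "encP (encL Num) (encP (encL Num) (encP (encL Num) (encP (encL (encL Num)) (encL Num))))"
  have "ptime UNIV ?e (encL Num)
     (\<lambda>y. xorl (fst (fst (snd (snd y)), fst (snd y), fst y))
       (fst (snd (fst (snd (snd y)), fst (snd y), fst y))) (snd (snd (fst (snd (snd y)), fst (snd y), fst y))))"
    by (rule ptime_app[OF ptime_xorl]) (rule ptime_rules)+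
  then have *: "ptime UNIV ?e (encL Num) (\<lambda>y. xorl (fst (snd (snd y))) (fst (snd y)) (fst y))" by simp
  show "ptime UNIV ?e (encL Num)
     (\<lambda>y. if hd (fst y) \<in> set (fst (snd y)) then xorl (fst (snd (snd y))) (fst (snd y)) (fst y) else fst (snd y))"
    by (rule ptime_if ptime_member[OF inj_Num] ptime_hd ptime_UNIV[OF *] ptime_rules)+
  fix x :: "nat list \<times> nat list list \<times> nat list" and us vs
  have "val_size (encL Num (reduce (fst x) us (snd (snd x))))
      \<le> max (val_size (encL Num (snd (snd x)))) (val_size (encL Num (fst x)))"
    by (rule val_size_reduce)
  also have "\<dots> \<le> val_size (encP (encL Num) (encP (encL (encL Num)) (encL Num)) x)"
    by (simp add: encP_def)
  finally show "val_size (encL Num (foldl (\<lambda>s a. if hd a \<in> set s then xorl (fst x) s a else s) (snd (snd x)) us))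
     \<le> val_size (encP (encL Num) (encP (encL (encL Num)) (encL Num)) x)"
    unfolding reduce_def .
qed (rule polyb_id ptime_rules)+

text \<open>Since the size of a reduced row is bounded independently of the rows collected so far,
  each round adds at most the size of the input.\<close>

lemma ptime_eliminate:
  "ptime UNIV (encP (encL Num) (encL (encL Num))) (encL (encL Num)) (\<lambda>y. eliminate (fst y) (snd y))"
  unfolding eliminate_def
proof (rule ptime_foldl_linear[where q = "\<lambda>n. n" and
      f = "\<lambda>l B y. if reduce (fst y) B l = [] then B else B @ [reduce (fst y) B l]"])
  let ?e = "encP (encL Num) (encP (encL (encL Num)) (encP (encL Num) (encL (encL Num))))"
  have "ptime UNIV ?e (encL Num)
     (\<lambda>y. reduce (fst (fst (snd (snd y)), fst (snd y), fst y))
       (fst (snd (fst (snd (snd y)), fst (snd y), fst y))) (snd (snd (fst (snd (snd y)), fst (snd y), fst y))))"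
    by (rule ptime_app[OF ptime_reduce]) (rule ptime_rules)+
  then have *: "ptime UNIV ?e (encL Num) (\<lambda>y. reduce (fst (snd (snd y))) (fst (snd y)) (fst y))" by simp
  show "ptime UNIV ?e (encL (encL Num))
     (\<lambda>y. if reduce (fst (snd (snd y))) (fst (snd y)) (fst y) = [] then fst (snd y)
           else fst (snd y) @ [reduce (fst (snd (snd y))) (fst (snd y)) (fst y)])"
    by (rule ptime_if ptime_null ptime_append ptime_Cons ptime_Nil ptime_UNIV[OF *] ptime_rules)+
  fix x :: "nat list \<times> nat list list" and a s
  assume a: "a \<in> set (snd x)"
  let ?r = "reduce (fst x) s a"
  have "val_size (encL Num ?r) < val_size (encP (encL Num) (encL (encL Num)) x)"
    using val_size_reduce[of "fst x" s a] val_size_member[OF a, of "encL Num"] by (simp add: encP_def)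
  then show "val_size (encL (encL Num) (if ?r = [] then s else s @ [?r]))
       \<le> val_size (encL (encL Num) s) + val_size (encP (encL Num) (encL (encL Num)) x)"
    by (simp add: val_size_encL)
qed (rule polyb_id ptime_Nil ptime_rules)+

lemma index_snoc: "index (P @ [p]) = index P @ [(p, length P + 1)]"
proof -
  have "length (index P) = length P" for P
    by (induction P rule: rev_induct) (simp_all add: index_def)
  then show ?thesis by (simp add: index_def)
qed

lemma val_size_index: "val_size (encL (encP Num Num) (index P))
    \<le> 1 + length P * (4 + length P + val_size (encL Num P))"
proof (induction P rule: rev_induct)
  case (snoc p P)
  \<comment> \<open>The bit length of a number is at most the number itself. The constant 4 collects
    the list cell, the pair, the constant part of \<open>Num\<close> and the increment of the
    length.\<close>
  have "floorlog 2 (length P + 1) \<le> length P + 1"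
    by (rule floorlog_leI) (use less_exp[of "length P + 1"] in auto)
  then have "val_size (encL (encP Num Num) (index (P @ [p]))) \<le> val_size (encL (encP Num Num) (index P))
      + (4 + length P + val_size (Num p))"
    by (simp add: index_snoc val_size_encL encP_def)
  also have "\<dots> \<le> 1 + length P * (4 + length P + val_size (encL Num P)) + (4 + length P + val_size (Num p))"
    using snoc by simp
  also have "\<dots> \<le> 1 + length (P @ [p]) * (4 + length (P @ [p]) + val_size (encL Num (P @ [p])))"
    (is "_ \<le> 1 + _ * ?X")
  proof -
    have X: "4 + length P + val_size (encL Num P) \<le> ?X" "4 + length P + val_size (Num p) \<le> ?X"
      by (simp_all add: val_size_encL)
    have "length P * (4 + length P + val_size (encL Num P)) \<le> length P * ?X"
      using X(1) by (rule mult_le_mono2)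
    moreover have "length (P @ [p]) * ?X = length P * ?X + ?X" by simp
    ultimately show ?thesis using X(2) by linarith
  qed
  finally show ?case .
qed (simp add: index_def encL_def floorlog_def)

lemma ptime_index: "ptime UNIV (encL Num) (encL (encP Num Num)) index"
proof -
  have "ptime UNIV (encL Num) (encL (encP Num Num)) (\<lambda>P. foldl (\<lambda>I p. I @ [(p, length I + 1)]) [] P)"
  proof (rule ptime_foldl[where q = "\<lambda>n. 1 + n * (4 + n + n)" and f = "\<lambda>p I P. I @ [(p, length I + 1)]"])
    show "ptime UNIV (encP Num (encP (encL (encP Num Num)) (encL Num))) (encL (encP Num Num))
       (\<lambda>y. fst (snd y) @ [(fst y, length (fst (snd y)) + 1)])"
      by (rule ptime_append ptime_Cons ptime_Nil ptime_plus ptime_nat ptime_length ptime_rules)+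
    fix x us vs :: "nat list"
    assume x: "x = us @ vs"
    have us: "val_size (encL Num us) \<le> val_size (encL Num x)" unfolding x by (simp add: val_size_encL)
    then have "length us \<le> val_size (encL Num x)"
      using length_le_val_size[of us Num] by simp
    then have "1 + length us * (4 + length us + val_size (encL Num us))
        \<le> 1 + val_size (encL Num x) * (4 + val_size (encL Num x) + val_size (encL Num x))"
      using us by (intro add_mono mult_le_mono) auto
    with val_size_index[of us]
    show "val_size (encL (encP Num Num) (foldl (\<lambda>I p. I @ [(p, length I + 1)]) [] us))
       \<le> 1 + val_size (encL Num x) * (4 + val_size (encL Num x) + val_size (encL Num x))"
      unfolding index_def by (rule le_trans)
  qed (rule polyb_intros ptime_Nil ptime_rules)+
  then show ?thesis unfolding index_def[abs_def] .
qed

lemma ptime_rows: "ptime UNIV (encL encE) (encL (encL Num)) rows"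
proof -
  have "ptime UNIV (encL encE) (encL (encL Num))
      (\<lambda>es. eliminate (fst (vars_of es, map fst es)) (snd (vars_of es, map fst es)))"
    by (rule ptime_app[OF ptime_eliminate])
      (rule ptime_Pair ptime_vars_of ptime_map[where g = "\<lambda>e es. fst e"] ptime_rules)+
  then show ?thesis unfolding rows_def[abs_def] by simp
qed

lemma ptime_restrict_eq:
  "ptime UNIV (encP encE (encL (encP Num Num))) encE (\<lambda>y. restrict_eq (snd y) (fst y))"
  unfolding restrict_eq_def
  by (rule ptime_Pair ptime_map[where g = "\<lambda>a y. snd a"]
      ptime_filter[where g = "\<lambda>a y. fst a \<in> set (fst (fst y))"] ptime_member[OF inj_Num] ptime_rules)+

lemma ptime_shrink: "ptime UNIV (encL encE) (encL encE) shrink"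
proof -
  let ?I = "\<lambda>es :: teq list. index (map hd (rows es))"
  have I: "ptime UNIV (encL encE) (encL (encP Num Num)) ?I"
    by (rule ptime_app[OF ptime_index] ptime_map[where g = "\<lambda>s es. hd s"] ptime_rows ptime_hd ptime_rules)+
  have "ptime UNIV (encP (encL encE) (encL (encP Num Num))) (encL encE)
      (\<lambda>y. map (\<lambda>e. restrict_eq (snd y) e) (fst y))"
  proof (rule ptime_map[where g = "\<lambda>e y. restrict_eq (snd y) e"])
    have "ptime UNIV (encP encE (encP (encL encE) (encL (encP Num Num)))) encE
       (\<lambda>y. restrict_eq (snd (fst y, snd (snd y))) (fst (fst y, snd (snd y))))"
      by (rule ptime_app[OF ptime_restrict_eq]) (rule ptime_rules)+
    then show "ptime UNIV (encP encE (encP (encL encE) (encL (encP Num Num)))) encE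
       (\<lambda>y. restrict_eq (snd (snd y)) (fst y))" by simp
  qed (rule ptime_rules)+
  from ptime_app[OF this ptime_Pair[OF ptime_id I]]
  show ?thesis unfolding shrink_def[abs_def] by simp
qed

lemma ptime_kernel: "ptime UNIV encI encI kernel"
proof -
  \<comment> \<open>Stated for every \<open>D\<close>, because \<open>ptime_if\<close> asks for each
    branch on its own subdomain.\<close>
  have U: "ptime D encI (encL encE) (\<lambda>y. unbalanced (fst (snd y)))" for D
    by (rule ptime_app[OF ptime_unbalanced]) (rule ptime_rules)+
  have R: "ptime D encI (encL (encL Num)) (\<lambda>y. rows (unbalanced (fst (snd y))))" for D
    by (rule ptime_app[OF ptime_rows U])
  have S: "ptime D encI (encL encE) (\<lambda>y. shrink (unbalanced (fst (snd y))))" for D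
    by (rule ptime_app[OF ptime_shrink U])
  show ?thesis
    unfolding kernel_def[abs_def]
    by (rule ptime_if ptime_le ptime_times ptime_minus ptime_nat ptime_length R S ptime_Nil ptime_rules)+
qed

section \<open>Correctness\<close>

definition excess :: "lin_eq list \<Rightarrow> (nat \<Rightarrow> int) \<Rightarrow> int" where
  "excess es x = (\<Sum>e\<leftarrow>es. int (eq_weight e) * eq_rhs e * chi (eq_vars e) x)"

text \<open>An equation of weight w adds w plus or minus w on the right, the sign being positive
  exactly when its right-hand side equals its character, that is, when it is satisfied.\<close>

lemma sat_weight_excess:
  assumes "x \<in> cube" "\<And>e. e \<in> set es \<Longrightarrow> eq_rhs e \<in> {-1, 1}"
  shows "2 * int (\<Sum>e\<leftarrow>filter (satisfies x) es. eq_weight e) = int (\<Sum>e\<leftarrow>es. eq_weight e) + excess es x"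
  using assms(2)
proof (induction es)
  case (Cons e es)
  have IH: "2 * int (\<Sum>e\<leftarrow>filter (satisfies x) es. eq_weight e) = int (\<Sum>e\<leftarrow>es. eq_weight e) + excess es x"
    using Cons by simp
  have "chi (eq_vars e) x = -1 \<or> chi (eq_vars e) x = 1" "eq_rhs e = -1 \<or> eq_rhs e = 1"
    using chi_sign[OF assms(1)] Cons.prems by auto
  moreover have "satisfies x e \<longleftrightarrow> chi (eq_vars e) x = eq_rhs e" by (simp add: satisfies_def chi_def)
  moreover have "excess (e # es) x = int (eq_weight e) * eq_rhs e * chi (eq_vars e) x + excess es x"
    by (simp add: excess_def)
  ultimately show ?case using IH by (elim disjE) simp_all
qed (simp add: excess_def)

lemma filter_satisfies_cong:
  assumes "valid_inst S" "\<And>i. i \<in> {1..num_vars S} \<Longrightarrow> x i = y i"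
  shows "filter (satisfies x) (eqns S) = filter (satisfies y) (eqns S)"
proof (rule filter_cong)
  fix e assume "e \<in> set (eqns S)"
  then have "eq_vars e \<subseteq> {1..num_vars S}" using assms(1) by (auto simp: valid_inst_def)
  then have "(\<Prod>i\<in>eq_vars e. x i) = (\<Prod>i\<in>eq_vars e. y i)" using assms(2) by (intro prod.cong) auto
  then show "satisfies x e = satisfies y e" by (simp add: satisfies_def)
qed simp

lemma yes_inst_iff_excess:
  assumes S: "valid_inst S"
  shows "yes_inst S \<longleftrightarrow> (\<exists>x\<in>cube. 2 * int (par_k S) \<le> excess (eqns S) x)"
proof -
  let ?X = "{1..num_vars S} \<rightarrow>\<^sub>E {-1, 1 :: int}"
  let ?w = "\<lambda>x. \<Sum>e\<leftarrow>filter (satisfies x) (eqns S). eq_weight e"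
  have fin: "finite (?w ` ?X)" "?w ` ?X \<noteq> {}" by (auto intro!: finite_imageI finite_PiE simp: PiE_eq_empty_iff)
  have rhs: "\<And>e. e \<in> set (eqns S) \<Longrightarrow> eq_rhs e \<in> {-1, 1}" using S by (auto simp: valid_inst_def)
  have real: "real s \<ge> real W / 2 + real k \<longleftrightarrow> W + 2 * k \<le> 2 * s" for s W k :: nat
    by (simp add: field_simps) linarith
  have ex: "2 * int k \<le> excess (eqns S) x \<longleftrightarrow> total_weight S + 2 * k \<le> 2 * ?w x" if "x \<in> cube" for x k
  proof -
    have "2 * int (?w x) = int (total_weight S) + excess (eqns S) x"
      unfolding total_weight_def by (rule sat_weight_excess[OF that rhs])
    then show ?thesis by linarith
  qed
  have "yes_inst S \<longleftrightarrow> (\<exists>x\<in>?X. total_weight S + 2 * par_k S \<le> 2 * ?w x)"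
  proof -
    have "sat S \<in> ?w ` ?X" unfolding sat_def using fin by (rule Max_in)
    moreover have "?w x \<le> sat S" if "x \<in> ?X" for x
      unfolding sat_def using fin that by (intro Max_ge) auto
    ultimately show ?thesis unfolding yes_inst_def real
      by (smt (verit, best) imageE le_trans mult_le_mono2)
  qed
  also have "\<dots> \<longleftrightarrow> (\<exists>x\<in>cube. total_weight S + 2 * par_k S \<le> 2 * ?w x)"
  proof
    assume "\<exists>x\<in>?X. total_weight S + 2 * par_k S \<le> 2 * ?w x"
    then obtain x where x: "x \<in> ?X" "total_weight S + 2 * par_k S \<le> 2 * ?w x" by blast
    \<comment> \<open>Extensional functions are undefined outside the variables; the value 1 there
      gives a point of \<open>cube\<close> without affecting any equation.\<close>
    let ?y = "\<lambda>i. if i \<in> {1..num_vars S} then x i else 1"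
    have "?y \<in> cube" using x(1) by (auto simp: cube_def PiE_def Pi_def)
    moreover have "?w ?y = ?w x" by (subst filter_satisfies_cong[OF S, of ?y x]) auto
    ultimately show "\<exists>x\<in>cube. total_weight S + 2 * par_k S \<le> 2 * ?w x" using x(2) by (intro bexI[of _ ?y]) auto
  next
    assume "\<exists>x\<in>cube. total_weight S + 2 * par_k S \<le> 2 * ?w x"
    then obtain x where x: "x \<in> cube" "total_weight S + 2 * par_k S \<le> 2 * ?w x" by blast
    let ?y = "restrict x {1..num_vars S}"
    have "?y \<in> ?X" using x(1) by (auto simp: cube_def)
    moreover have "?w ?y = ?w x" by (subst filter_satisfies_cong[OF S, of ?y x]) auto
    ultimately show "\<exists>x\<in>?X. total_weight S + 2 * par_k S \<le> 2 * ?w x" using x(2) by (intro bexI[of _ ?y]) auto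
  qed
  also have "\<dots> \<longleftrightarrow> (\<exists>x\<in>cube. 2 * int (par_k S) \<le> excess (eqns S) x)" using ex by blast
  finally show ?thesis .
qed

definition of_teq :: "teq \<Rightarrow> lin_eq" where
  "of_teq e = \<lparr>eq_vars = set (fst e), eq_rhs = (if fst (snd e) = 1 then 1 else -1),
    eq_weight = fst (snd (snd e))\<rparr>"

definition of_tinst :: "tinst \<Rightarrow> lin_inst" where
  "of_tinst y = \<lparr>num_vars = fst y, eqns = map of_teq (fst (snd y)), par_k = fst (snd (snd y)),
    par_r = fst (snd (snd (snd y)))\<rparr>"

definition to_teq :: "lin_eq \<Rightarrow> teq" where
  "to_teq e = (sorted_list_of_set (eq_vars e), if eq_rhs e = 1 then 1 else 0, eq_weight e, ())"

definition to_tinst :: "lin_inst \<Rightarrow> tinst" where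
  "to_tinst S = (num_vars S, map to_teq (eqns S), par_k S, par_r S, ())"

text \<open>\<open>enc_eq\<close> sorts the variables and normalizes the sign bit; these are the
  tuples that survive decoding and re-encoding unchanged.\<close>

definition canonical :: "teq \<Rightarrow> bool" where
  "canonical e \<longleftrightarrow> sorted (fst e) \<and> distinct (fst e) \<and> fst (snd e) \<in> {0, 1}"

lemma encI_to_tinst: "encI (to_tinst S) = enc_inst S"
proof -
  have "encE (to_teq e) = enc_eq e" for e
    by (simp add: to_teq_def enc_eq_def encP_def encL_def encU_def)
  then show ?thesis by (simp add: to_tinst_def enc_inst_def encP_def encL_def encU_def comp_def)
qed

lemma enc_inst_of_tinst:
  assumes "\<And>e. e \<in> set (fst (snd y)) \<Longrightarrow> canonical e"
  shows "enc_inst (of_tinst y) = encI y"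
proof -
  have "enc_eq (of_teq e) = encE e" if "e \<in> set (fst (snd y))" for e
    using assms[OF that]
    by (auto simp: canonical_def of_teq_def enc_eq_def encP_def encL_def encU_def
        sorted_list_of_set.idem_if_sorted_distinct)
  then have *: "map enc_eq (map of_teq (fst (snd y))) = map encE (fst (snd y))" by simp
  have "encI y = enc_list [Num (fst y), enc_list (map encE (fst (snd y))), Num (fst (snd (snd y))),
      Num (fst (snd (snd (snd y))))]"
    by (simp add: encP_def encL_def encU_def)
  then show ?thesis unfolding *[symmetric] by (simp add: of_tinst_def enc_inst_def)
qed

lemma canonical_to_teq: "canonical (to_teq e)"
  by (simp add: canonical_def to_teq_def)

lemma of_tinst_to_tinst:
  assumes "valid_inst S"
  shows "of_tinst (to_tinst S) = S"
proof -
  have "of_teq (to_teq e) = e" if "e \<in> set (eqns S)" for e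
  proof -
    have "eq_vars e \<subseteq> {1..num_vars S}" "eq_rhs e \<in> {-1, 1}"
      using assms that unfolding valid_inst_def by blast+
    moreover from this(1) have "finite (eq_vars e)" by (rule finite_subset) simp
    ultimately show ?thesis by (auto simp: of_teq_def to_teq_def)
  qed
  then have "map (of_teq \<circ> to_teq) (eqns S) = eqns S" by (simp add: map_idI)
  then show ?thesis by (simp add: of_tinst_def to_tinst_def)
qed

section \<open>Coefficients and cancelling equations\<close>

definition signed_weight :: "teq \<Rightarrow> int" where
  "signed_weight e = int (eq_weight (of_teq e)) * eq_rhs (of_teq e)"

definition coef :: "teq list \<Rightarrow> nat list \<Rightarrow> int" where
  "coef es l = (\<Sum>e\<leftarrow>es. if fst e = l then signed_weight e else 0)"

lemma excess_of_teq: "excess (map of_teq es) x = (\<Sum>e\<leftarrow>es. signed_weight e * chi (set (fst e)) x)"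
  by (simp add: excess_def signed_weight_def comp_def) (simp add: of_teq_def)

lemma coef_wsum:
  assumes "\<And>e. e \<in> set es \<Longrightarrow> canonical e"
  shows "coef es l = int (wsum 1 l es) - int (wsum 0 l es)"
  using assms
proof (induction es rule: rev_induct)
  case (snoc e es)
  have "fst (snd e) = 0 \<or> fst (snd e) = 1" using snoc.prems[of e] by (auto simp: canonical_def)
  then show ?case using snoc by (auto simp: coef_def wsum_def signed_weight_def of_teq_def)
qed (simp add: coef_def wsum_def)

lemma excess_group:
  assumes "finite F" "fst ` set es \<subseteq> F"
  shows "excess (map of_teq es) x = (\<Sum>l\<in>F. coef es l * chi (set l) x)"
  using assms(2)
proof (induction es)
  case (Cons e es)
  have "(\<Sum>l\<in>F. coef (e # es) l * chi (set l) x)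
      = (\<Sum>l\<in>F. (if fst e = l then signed_weight e * chi (set l) x else 0) + coef es l * chi (set l) x)"
    by (rule sum.cong) (auto simp: coef_def algebra_simps)
  also have "\<dots> = signed_weight e * chi (set (fst e)) x + (\<Sum>l\<in>F. coef es l * chi (set l) x)"
    using assms(1) Cons.prems by (simp add: sum.distrib sum.delta)
  also have "\<dots> = excess (map of_teq (e # es)) x"
    using Cons by (simp add: excess_def signed_weight_def) (simp add: of_teq_def)
  finally show ?case ..
qed (simp add: excess_def coef_def)

lemma coef_filter:
  "coef (filter (\<lambda>e. Q (fst e)) es) l = (if Q l then coef es l else 0)"
  by (induction es) (auto simp: coef_def)

lemma unbalanced_filter:
  assumes "\<And>e. e \<in> set es \<Longrightarrow> canonical e"
  shows "unbalanced es = filter (\<lambda>e. coef es (fst e) \<noteq> 0) es"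
  unfolding unbalanced_def using coef_wsum[OF assms] by (intro filter_cong) auto

text \<open>The test looks only at the left-hand side, so equations sharing it are kept or dropped
  together, and a dropped group had coefficient 0 anyway.\<close>

lemma coef_unbalanced:
  assumes "\<And>e. e \<in> set es \<Longrightarrow> canonical e"
  shows "coef (unbalanced es) l = coef es l"
proof -
  have "unbalanced es = filter (\<lambda>e. coef es (fst e) \<noteq> 0) es" using assms by (rule unbalanced_filter)
  then show ?thesis by (simp add: coef_filter[where Q = "\<lambda>l. coef es l \<noteq> 0"])
qed

lemma excess_unbalanced:
  assumes "\<And>e. e \<in> set es \<Longrightarrow> canonical e"
  shows "excess (map of_teq (unbalanced es)) x = excess (map of_teq es) x"
proof -
  have "fst ` set (unbalanced es) \<subseteq> fst ` set es" by (auto simp: unbalanced_def)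
  then show ?thesis
    using coef_unbalanced[OF assms] by (simp add: excess_group[of "fst ` set es"])
qed

section \<open>Renumbering the pivot variables\<close>

lemma index_vars:
  "map snd (filter (\<lambda>a. fst a \<in> L) (index P)) = filter (\<lambda>i. P ! (i - 1) \<in> L) [1..<Suc (length P)]"
proof (induction P rule: rev_induct)
  case (snoc p P)
  have "filter (\<lambda>i. (P @ [p]) ! (i - 1) \<in> L) [1..<Suc (length P)] = filter (\<lambda>i. P ! (i - 1) \<in> L) [1..<Suc (length P)]"
    by (rule filter_cong) (auto simp: nth_append)
  then show ?case using snoc by (simp add: index_snoc)
qed (simp add: index_def)

text \<open>New variable \<open>i\<close> stands for \<open>P ! (i - 1)\<close>: variables are
  counted from 1, list positions from 0.\<close>

definition slots :: "nat list \<Rightarrow> nat set \<Rightarrow> nat set" where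
  "slots P L = {i \<in> {1..length P}. P ! (i - 1) \<in> L}"

lemma fst_restrict_eq:
  "fst (restrict_eq (index P) e) = filter (\<lambda>i. P ! (i - 1) \<in> set (fst e)) [1..<Suc (length P)]"
  by (simp add: restrict_eq_def index_vars del: upt_Suc)

lemma set_restrict_eq: "set (fst (restrict_eq (index P) e)) = slots P (set (fst e))"
  by (auto simp: fst_restrict_eq slots_def simp del: upt_Suc)

lemma canonical_restrict_eq: "canonical e \<Longrightarrow> canonical (restrict_eq (index P) e)"
  unfolding canonical_def fst_restrict_eq
  by (simp add: restrict_eq_def sorted_wrt_filter sorted_filter del: upt_Suc)

lemma slots_bij:
  assumes "distinct P"
  shows "bij_betw (\<lambda>i. P ! (i - 1)) (slots P L) (L \<inter> set P)"
  unfolding bij_betw_def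
proof
  show "inj_on (\<lambda>i. P ! (i - 1)) (slots P L)"
    using assms by (auto simp: inj_on_def slots_def nth_eq_iff_index_eq)
  show "(\<lambda>i. P ! (i - 1)) ` slots P L = L \<inter> set P"
  proof (intro subset_antisym subsetI)
    fix p assume "p \<in> L \<inter> set P"
    then obtain i where "i < length P" "p = P ! i" "p \<in> L" by (auto simp: in_set_conv_nth)
    then show "p \<in> (\<lambda>i. P ! (i - 1)) ` slots P L" by (intro image_eqI[of _ _ "Suc i"]) (auto simp: slots_def)
  qed (auto simp: slots_def)
qed

text \<open>Variables outside \<open>P\<close> contribute factors 1; the remaining product is
  reindexed by the slots.\<close>

lemma chi_slots:
  assumes "distinct P" "finite L" "\<And>i. i \<in> {1..length P} \<Longrightarrow> z (P ! (i - 1)) = y i"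
    "\<And>j. j \<notin> set P \<Longrightarrow> z j = 1"
  shows "chi L z = chi (slots P L) y"
proof -
  have "chi L z = (\<Prod>j\<in>L \<inter> set P. z j)"
    unfolding chi_def using assms(2,4) by (intro prod.mono_neutral_right) auto
  also have "\<dots> = (\<Prod>i\<in>slots P L. z (P ! (i - 1)))"
    by (rule prod.reindex_bij_betw[OF slots_bij[OF assms(1)], symmetric])
  also have "\<dots> = chi (slots P L) y"
    unfolding chi_def using assms(3) by (intro prod.cong) (auto simp: slots_def)
  finally show ?thesis .
qed

definition eqs_wf :: "nat \<Rightarrow> nat \<Rightarrow> teq list \<Rightarrow> bool" where
  "eqs_wf n r es \<longleftrightarrow> (\<forall>e\<in>set es. canonical e \<and> fst e \<noteq> [] \<and> set (fst e) \<subseteq> {1..n} \<and>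
    card (set (fst e)) \<le> r \<and> 0 < fst (snd (snd e)))"

lemma rows_props:
  shows "echelon (rows es)"
    and "set ` set (map fst es) \<subseteq> M \<Longrightarrow> s \<in> set (rows es) \<Longrightarrow> set s \<in> xspan M"
    and "x \<in> cube \<Longrightarrow> y \<in> cube \<Longrightarrow> (\<And>s. s \<in> set (rows es) \<Longrightarrow> chi (set s) x = chi (set s) y) \<Longrightarrow>
      e \<in> set es \<Longrightarrow> chi (set (fst e)) x = chi (set (fst e)) y"
proof -
  have "\<forall>l\<in>set (map fst es). set l \<subseteq> set (vars_of es)" by (auto simp: set_vars_of)
  note inv = eliminate_invariant[OF this, folded rows_def]
  show "echelon (rows es)" using inv[THEN conjunct1] .
  show "set s \<in> xspan M" if "set ` set (map fst es) \<subseteq> M" "s \<in> set (rows es)"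
    using inv[THEN conjunct2, THEN conjunct2, THEN conjunct1] that by blast
  assume x: "x \<in> cube" and y: "y \<in> cube" and e: "e \<in> set es"
    and xy: "\<And>s. s \<in> set (rows es) \<Longrightarrow> chi (set s) x = chi (set s) y"
  have "\<forall>l\<in>set (map fst es). chi (set l) x = chi (set l) y"
    using inv[THEN conjunct2, THEN conjunct2, THEN conjunct2] x y xy by blast
  then show "chi (set (fst e)) x = chi (set (fst e)) y" using e by simp
qed

text \<open>The pivots are distinct and lie in one finite span member \<open>Y\<close>, so
  \<open>card Y\<close> is at least the number of rows and \<open>excess_ge\<close> applies.\<close>

lemma exists_large_excess:
  assumes wf: "eqs_wf n r es" and coef: "\<And>e. e \<in> set es \<Longrightarrow> coef es (fst e) \<noteq> 0"
    and big: "r * (q - 1) < length (rows es)"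
  shows "\<exists>x\<in>cube. int q \<le> excess (map of_teq es) x"
proof -
  define F where "F = set ` fst ` set es"
  \<comment> \<open>A canonical list is the sorted list of its set, so this transfers the
    coefficients from lists to sets.\<close>
  define c where "c A = coef es (sorted_list_of_set A)" for A
  have sl: "sorted_list_of_set (set l) = l" if "l \<in> fst ` set es" for l
  proof -
    have "sorted l" "distinct l" using wf that unfolding eqs_wf_def canonical_def by blast+
    then show ?thesis by (rule sorted_list_of_set.idem_if_sorted_distinct)
  qed
  have F: "finite F" "F \<subseteq> Pow (set (vars_of es))" by (auto simp: F_def set_vars_of)
  have F_elem: "c A \<noteq> 0 \<and> A \<noteq> {} \<and> card A \<le> r \<and> finite A" if A: "A \<in> F" for A
  proof -
    obtain e where e: "e \<in> set es" "A = set (fst e)" using A unfolding F_def by blast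
    then have "c A = coef es (fst e)" unfolding c_def using sl[of "fst e"] by simp
    moreover have "fst e \<noteq> []" "card (set (fst e)) \<le> r" using wf e(1) unfolding eqs_wf_def by blast+
    ultimately show ?thesis using coef[OF e(1)] e(2) by simp
  qed
  have M: "F = {A \<in> F. c A \<noteq> 0}" and ne: "{} \<notin> F" using F_elem by blast+
  have "\<And>s. s \<in> set (rows es) \<Longrightarrow> set s \<in> xspan F"
    by (rule rows_props(2)[of es]) (auto simp: F_def)
  then obtain Y where Y: "Y \<in> xspan F" "set (map hd (rows es)) \<subseteq> Y"
    using echelon_span_pivots[OF rows_props(1)] by blast
  have "finite Y"
  proof -
    obtain T where "finite T" "T \<subseteq> F" "Y = sd T" using Y(1) unfolding xspan_def by blast
    then show ?thesis using F_elem finite_sd[of T] by blast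
  qed
  then have "length (rows es) \<le> card Y"
    using card_mono[OF _ Y(2)] distinct_card[OF echelon_distinct[OF rows_props(1)[of es]]] by simp
  then have "r * (q - 1) < card Y" using big by simp
  then obtain x where x: "x \<in> signs (set (vars_of es))" "int q \<le> (\<Sum>A\<in>F. c A * chi A x)"
    using excess_ge[OF finite_set F M ne _ Y(1), of r q] F_elem by blast
  have "(\<Sum>A\<in>F. c A * chi A x) = (\<Sum>l\<in>fst ` set es. coef es l * chi (set l) x)"
  proof -
    have "inj_on set (fst ` set es)" using sl by (rule inj_on_inverseI)
    then have "(\<Sum>A\<in>F. c A * chi A x) = (\<Sum>l\<in>fst ` set es. c (set l) * chi (set l) x)"
      unfolding F_def by (simp add: sum.reindex)
    also have "\<dots> = (\<Sum>l\<in>fst ` set es. coef es l * chi (set l) x)"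
      by (rule sum.cong) (simp_all add: c_def sl)
    finally show ?thesis .
  qed
  also have "\<dots> = excess (map of_teq es) x" by (rule excess_group[symmetric]) auto
  finally show ?thesis using x signs_cube by (intro bexI[of _ x]) auto
qed

text \<open>Given an assignment of the large system, \<open>echelon_adjust\<close> with target 1 off
  the pivots finds one with the same row values, hence the same value on each equation; the small
  system can read it off. Conversely, an assignment of the slots extends by 1.\<close>

lemma excess_shrink:
  assumes "eqs_wf n r es"
  shows "(\<exists>x\<in>cube. m \<le> excess (map of_teq (shrink es)) x) \<longleftrightarrow> (\<exists>x\<in>cube. m \<le> excess (map of_teq es) x)"
proof -
  define P where "P = map hd (rows es)"
  have P: "distinct P" unfolding P_def by (rule echelon_distinct[OF rows_props(1)])
  have sh: "shrink es = map (restrict_eq (index P)) es" by (simp add: shrink_def P_def)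
  have sw: "signed_weight (restrict_eq I e) = signed_weight e" for I e
    by (simp add: signed_weight_def of_teq_def restrict_eq_def)
  have ex: "excess (map of_teq (shrink es)) y = (\<Sum>e\<leftarrow>es. signed_weight e * chi (slots P (set (fst e))) y)" for y
    unfolding excess_of_teq sh by (simp add: comp_def sw set_restrict_eq)
  show ?thesis
  proof
    assume "\<exists>x\<in>cube. m \<le> excess (map of_teq es) x"
    then obtain x where x: "x \<in> cube" "m \<le> excess (map of_teq es) x" by blast
    have "(\<lambda>_. 1) \<in> cube" by (simp add: cube_def)
    from echelon_adjust[OF rows_props(1) x(1) this, of es] obtain z where z: "z \<in> cube"
      "\<And>i. i \<notin> set P \<Longrightarrow> z i = 1" "\<And>s. s \<in> set (rows es) \<Longrightarrow> chi (set s) z = chi (set s) x"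
      unfolding P_def by blast
    define y where "y i = (if i \<in> {1..length P} then z (P ! (i - 1)) else 1)" for i
    have *: "chi (slots P (set (fst e))) y = chi (set (fst e)) x" if "e \<in> set es" for e
    proof -
      have "chi (set (fst e)) z = chi (slots P (set (fst e))) y"
        by (rule chi_slots[OF P]) (simp_all add: y_def z(2))
      then show ?thesis using rows_props(3)[OF z(1) x(1) z(3) that] by simp
    qed
    have "excess (map of_teq (shrink es)) y = excess (map of_teq es) x"
      by (subst ex, subst excess_of_teq, rule arg_cong[where f = sum_list], rule map_cong) (simp_all add: *)
    moreover have "y \<in> cube" using z(1) by (simp add: cube_def y_def)
    ultimately show "\<exists>x\<in>cube. m \<le> excess (map of_teq (shrink es)) x"
      using x(2) by (intro bexI[of _ y]) simp_all
  next
    assume "\<exists>y\<in>cube. m \<le> excess (map of_teq (shrink es)) y"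
    then obtain y where y: "y \<in> cube" "m \<le> excess (map of_teq (shrink es)) y" by blast
    \<comment> \<open>Inverting the numbering sends each pivot back to its slot.\<close>
    define z where "z j = (if j \<in> set P then y (inv_into {1..length P} (\<lambda>i. P ! (i - 1)) j) else 1)" for j
    have inj: "inj_on (\<lambda>i. P ! (i - 1)) {1..length P}"
      using P by (auto simp: inj_on_def nth_eq_iff_index_eq)
    have zP: "z (P ! (i - 1)) = y i" if "i \<in> {1..length P}" for i
    proof -
      have "P ! (i - 1) \<in> set P" using that by (intro nth_mem) auto
      then show ?thesis using inv_into_f_f[OF inj that] by (simp add: z_def)
    qed
    have "chi (set (fst e)) z = chi (slots P (set (fst e))) y" for e :: teq
    proof (rule chi_slots[OF P finite_set])
      show "z (P ! (i - 1)) = y i" if "i \<in> {1..length P}" for i using that by (rule zP)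
      show "z j = 1" if "j \<notin> set P" for j using that by (simp add: z_def)
    qed
    then have "excess (map of_teq es) z = excess (map of_teq (shrink es)) y"
      by (subst ex, subst excess_of_teq) simp
    moreover have "z \<in> cube" using y(1) by (simp add: cube_def z_def)
    ultimately show "\<exists>x\<in>cube. m \<le> excess (map of_teq es) x"
      using y(2) by (intro bexI[of _ z]) simp_all
  qed
qed

text \<open>Flipping a single variable of \<open>l\<close> and repairing the rows at the pivots would leave the
  value of \<open>l\<close> negative if \<open>l\<close> contained no pivot.\<close>

lemma pivot_in_equation:
  assumes e: "e \<in> set es" and ne: "fst e \<noteq> []"
  shows "set (fst e) \<inter> set (map hd (rows es)) \<noteq> {}"
proof
  assume disj: "set (fst e) \<inter> set (map hd (rows es)) = {}"
  obtain i where i: "i \<in> set (fst e)" using ne by (meson list.set_sel(1))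
  define y where "y = (\<lambda>_ :: nat. 1 :: int)(i := -1)"
  have cube: "(\<lambda>_. 1) \<in> cube" "y \<in> cube" by (auto simp: cube_def y_def)
  from echelon_adjust[OF rows_props(1) cube, of es] obtain z where z: "z \<in> cube"
    "\<And>i. i \<notin> set (map hd (rows es)) \<Longrightarrow> z i = y i"
    "\<And>s. s \<in> set (rows es) \<Longrightarrow> chi (set s) z = chi (set s) (\<lambda>_. 1)" by blast
  have "chi (set (fst e)) z = 1"
    using rows_props(3)[OF z(1) cube(1) z(3) e] by (simp add: chi_def)
  moreover have "chi (set (fst e)) z = chi (set (fst e)) y"
    unfolding chi_def using z(2) disj by (intro prod.cong) auto
  moreover have "chi (set (fst e)) y = -1"
  proof -
    have "(\<Prod>j\<in>set (fst e) - {i}. y j) = 1" by (rule prod.neutral) (simp add: y_def)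
    then show ?thesis unfolding chi_def using prod.remove[OF finite_set i, of y] by (simp add: y_def)
  qed
  ultimately show False by simp
qed

text \<open>Restriction can only lower the number of variables per equation, so \<open>r\<close>
  survives. The danger is an empty left-hand side, which validity forbids and
  \<open>pivot_in_equation\<close> excludes.\<close>

lemma eqs_wf_shrink:
  assumes wf: "eqs_wf n r es"
  shows "eqs_wf (length (rows es)) r (shrink es)"
  unfolding eqs_wf_def
proof
  define P where "P = map hd (rows es)"
  have P: "distinct P" unfolding P_def by (rule echelon_distinct[OF rows_props(1)])
  fix e' assume "e' \<in> set (shrink es)"
  then obtain e where e: "e \<in> set es" "e' = restrict_eq (index P) e" by (auto simp: shrink_def P_def)
  have e_wf: "canonical e" "fst e \<noteq> []" "card (set (fst e)) \<le> r" "0 < fst (snd (snd e))"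
    using wf e(1) unfolding eqs_wf_def by blast+
  have set: "set (fst e') = slots P (set (fst e))" unfolding e(2) by (rule set_restrict_eq)
  have bij: "bij_betw (\<lambda>i. P ! (i - 1)) (set (fst e')) (set (fst e) \<inter> set P)"
    unfolding set by (rule slots_bij[OF P])
  have "set (fst e) \<inter> set P \<noteq> {}" unfolding P_def by (rule pivot_in_equation[OF e(1) e_wf(2)])
  then have "fst e' \<noteq> []" using bij_betw_imp_surj_on[OF bij] by (metis empty_set image_empty)
  moreover have "card (set (fst e')) \<le> r"
    using bij_betw_same_card[OF bij] card_mono[of "set (fst e)" "set (fst e) \<inter> set P"] e_wf(3) by simp
  moreover have "set (fst e') \<subseteq> {1..length (rows es)}" unfolding set by (auto simp: slots_def P_def)
  moreover have "canonical e'" unfolding e(2) by (rule canonical_restrict_eq[OF e_wf(1)])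
  moreover have "0 < fst (snd (snd e'))" using e_wf(4) by (simp add: e(2) restrict_eq_def)
  ultimately show "canonical e' \<and> fst e' \<noteq> [] \<and> set (fst e') \<subseteq> {1..length (rows es)} \<and>
      card (set (fst e')) \<le> r \<and> 0 < fst (snd (snd e'))" by blast
qed

lemma valid_of_tinst: "eqs_wf n r es \<Longrightarrow> valid_inst (of_tinst (n, es, k, r, u))"
  by (auto simp: valid_inst_def of_tinst_def of_teq_def eqs_wf_def)

lemma yes_of_tinst:
  assumes "eqs_wf n r es"
  shows "yes_inst (of_tinst (n, es, k, r, u)) \<longleftrightarrow> (\<exists>x\<in>cube. 2 * int k \<le> excess (map of_teq es) x)"
  using yes_inst_iff_excess[OF valid_of_tinst[OF assms]] by (simp add: of_tinst_def)

lemma eqs_wf_to_teq: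
  assumes "valid_inst S"
  shows "eqs_wf (num_vars S) (par_r S) (map to_teq (eqns S))"
proof -
  have "canonical (to_teq e) \<and> fst (to_teq e) \<noteq> [] \<and> set (fst (to_teq e)) \<subseteq> {1..num_vars S} \<and>
      card (set (fst (to_teq e))) \<le> par_r S \<and> 0 < fst (snd (snd (to_teq e)))"
    if "e \<in> set (eqns S)" for e
  proof -
    have e: "eq_vars e \<noteq> {}" "eq_vars e \<subseteq> {1..num_vars S}" "card (eq_vars e) \<le> par_r S" "0 < eq_weight e"
      using assms that unfolding valid_inst_def by blast+
    have "finite (eq_vars e)" using e(2) by (rule finite_subset) simp
    then show ?thesis using e by (simp add: canonical_to_teq) (simp add: to_teq_def)
  qed
  then show ?thesis by (simp add: eqs_wf_def)
qed

lemma kernel_correct: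
  assumes S: "valid_inst S"
  defines "y \<equiv> kernel (to_tinst S)"
  shows "(\<forall>e\<in>set (fst (snd y)). canonical e) \<and> valid_inst (of_tinst y) \<and>
    (yes_inst (of_tinst y) \<longleftrightarrow> yes_inst S) \<and> par_k (of_tinst y) \<le> par_k S \<and>
    par_r (of_tinst y) = par_r S \<and> num_vars (of_tinst y) \<le> (2 * par_k S - 1) * par_r S"
proof -
  define es U where "es = map to_teq (eqns S)" and "U = unbalanced es"
  define n k r where "n = num_vars S" and "k = par_k S" and "r = par_r S"
  have wf: "eqs_wf n r es" unfolding es_def n_def r_def by (rule eqs_wf_to_teq[OF S])
  have can: "\<And>e. e \<in> set es \<Longrightarrow> canonical e" using wf by (simp add: eqs_wf_def)
  have U_wf: "eqs_wf n r U" using wf by (simp add: eqs_wf_def U_def unbalanced_def)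
  have U_ex: "excess (map of_teq U) x = excess (map of_teq es) x" for x
    unfolding U_def using can by (rule excess_unbalanced)
  have "\<forall>e\<in>set U. coef es (fst e) \<noteq> 0" unfolding U_def using unbalanced_filter[of es] can by auto
  moreover have "coef U l = coef es l" for l unfolding U_def using can by (rule coef_unbalanced)
  ultimately have U_coef: "\<And>e. e \<in> set U \<Longrightarrow> coef U (fst e) \<noteq> 0" by simp
  have S_eq: "S = of_tinst (n, es, k, r, ())"
    using of_tinst_to_tinst[OF S] by (simp add: to_tinst_def n_def es_def k_def r_def)
  have S_yes: "yes_inst S \<longleftrightarrow> (\<exists>x\<in>cube. 2 * int k \<le> excess (map of_teq U) x)"
    unfolding U_ex using yes_of_tinst[OF wf, of k "()"] by (simp flip: S_eq)
  show ?thesis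
  proof (cases "length (rows U) \<le> (2 * k - 1) * r")
    case True
    then have y: "y = (length (rows U), shrink U, k, r, ())"
      by (simp add: y_def kernel_def to_tinst_def U_def es_def k_def r_def)
    have sh: "eqs_wf (length (rows U)) r (shrink U)" by (rule eqs_wf_shrink[OF U_wf])
    have "yes_inst (of_tinst y) \<longleftrightarrow> yes_inst S"
      unfolding y yes_of_tinst[OF sh] S_yes by (rule excess_shrink[OF U_wf])
    moreover have "valid_inst (of_tinst y)" unfolding y by (rule valid_of_tinst[OF sh])
    moreover have "\<forall>e\<in>set (fst (snd y)). canonical e" using sh by (simp add: y eqs_wf_def)
    ultimately show ?thesis using True by (simp add: y of_tinst_def k_def r_def)
  next
    case False
    then have y: "y = (0, [], 0, r, ())"
      by (simp add: y_def kernel_def to_tinst_def U_def es_def k_def r_def)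
    have nil: "eqs_wf 0 r []" by (simp add: eqs_wf_def)
    have "yes_inst (of_tinst y)"
      unfolding y yes_of_tinst[OF nil] by (auto simp: excess_def cube_def)
    \<comment> \<open>With \<open>q = 2 * k\<close> the failed test is exactly the hypothesis on the
      number of rows.\<close>
    moreover have "yes_inst S"
      using exists_large_excess[OF U_wf U_coef, of "2 * k"] False
      unfolding S_yes by (simp add: mult.commute)
    moreover have "valid_inst (of_tinst y)" unfolding y by (rule valid_of_tinst[OF nil])
    ultimately show ?thesis by (simp add: y of_tinst_def r_def)
  qed
qed

theorem theorem5:
  "\<exists>(K :: lin_inst \<Rightarrow> lin_inst) (g :: nat \<Rightarrow> nat \<Rightarrow> nat).
     polytime_computable enc_inst enc_inst {S. valid_inst S} K \<and>
     (\<forall>S. valid_inst S \<longrightarrow>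
        valid_inst (K S) \<and>
        (yes_inst (K S) \<longleftrightarrow> yes_inst S) \<and>
        par_k (K S) \<le> g (par_k S) (par_r S) \<and>
        par_r (K S) \<le> g (par_k S) (par_r S) \<and>
        num_vars (K S) \<le> (2 * par_k S - 1) * par_r S)"
proof (intro exI conjI allI impI)
  let ?K = "\<lambda>S. of_tinst (kernel (to_tinst S))"
  obtain P main p where P: "\<And>y. \<exists>t. big_step P [encI y] main (encI (kernel y)) t \<and> t \<le> poly p (val_size (encI y))"
    using polytime_computableI[OF ptime_kernel] unfolding polytime_computable_def by blast
  \<comment> \<open>Records and tuples have the same codes, so the program for \<open>kernel\<close>
    computes \<open>?K\<close> without any conversion.\<close>
  have "enc_inst (?K S) = encI (kernel (to_tinst S))" if "valid_inst S" for S
    using kernel_correct[OF that] by (intro enc_inst_of_tinst) blast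
  then have "\<forall>S\<in>{S. valid_inst S}. \<exists>t. big_step P [enc_inst S] main (enc_inst (?K S)) t \<and>
      t \<le> poly p (val_size (enc_inst S))"
    using P by (simp flip: encI_to_tinst)
  then show "polytime_computable enc_inst enc_inst {S. valid_inst S} ?K"
    unfolding polytime_computable_def by blast
  fix S assume S: "valid_inst S"
  note K = kernel_correct[OF S]
  show "valid_inst (?K S)" "yes_inst (?K S) \<longleftrightarrow> yes_inst S"
    "num_vars (?K S) \<le> (2 * par_k S - 1) * par_r S"
    using K by blast+
  \<comment> \<open>This fixes the bounding function as the sum of the two parameters.\<close>
  show "par_k (?K S) \<le> par_k S + par_r S" "par_r (?K S) \<le> par_k S + par_r S" using K by linarith+
qed

end
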